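(* Let $R$ be a ring of the standard form below and suppose the list $[(q_1,n_1),\dots,(q_t,n_t)]$ is separating. Then the partition $\mathcal P_{\rm hom}$ induced by the normalized homogeneous weight equals the partition $\mathcal H'$. Consequently $\mathcal P_{\rm hom}$ is reflexive, and its left and right duals (which do not depend on the generating character) both equal the dual of $\mathcal H'$, namely the partition with blocks $\mathrm{rad}(R)\setminus\{0\}$, $\{0\}$, and $Q_m=\{a\in R\setminus\mathrm{rad}(R):|\{j:a_{i,j}\notin\mathrm{rad}(R_{i,j})\}|=m_i\ \forall i\}$ for $m\in\mathcal M\setminus\{0\}$ (empty sets discarded). Moreover, if $R=\mathrm{soc}(R)$ (i.e. $R$ is semisimple), then $\mathcal P_{\rm hom}$ coincides with the product of the Hamming partitions on the $R_i$ and is self-dual.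
   Context: Standard form: $R=R_1\times\cdots\times R_t$, $R_i=R_{i,1}\times\cdots\times R_{i,n_i}$, each $R_{i,j}$ a finite local Frobenius ring with $|R_{i,j}/\mathrm{rad}(R_{i,j})|=|\mathrm{soc}(R_{i,j})|=q_i$, and $q_1,\dots,q_t$ distinct ($\mathrm{rad}$ = Jacobson radical, $\mathrm{soc}$ = socle; a finite ring is Frobenius if it has a generating character $\chi$, i.e. a character of its additive group with $r\mapsto(x\mapsto\chi(xr))$ bijective onto the character group). Write $a=(a_1,\dots,a_t)$, $a_i=(a_{i,1},\dots,a_{i,n_i})$, $\mathrm{wt}(a_i)=|\{j:a_{i,j}\ne0\}|$, and $\mathcal M=\{0,\dots,n_1\}\times\cdots\times\{0,\dots,n_t\}$. $\mathcal H'$ is the partition of $R$ with blocks $R\setminus\mathrm{soc}(R)$ (if nonempty) and $P_m=\{a\in\mathrm{soc}(R):\mathrm{wt}(a_i)=m_i\ \forall i\}$, $m\in\mathcal M$. A list $[(q_1,n_1),\dots,(q_t,n_t)]$ is separating if for all $m\ne\ell$ in $\mathcal M$: $\prod_i(q_i-1)^{m_i}\ne\prod_i(q_i-1)^{\ell_i}$ or $\sum_i m_i\not\equiv\sum_i\ell_i\pmod 2$. The normalized homogeneous weight is the unique $\omega:R\to\mathbb Q$ with $\omega(0)=0$, $\omega(x)=\omega(y)$ if $Rx=Ry$, and $\sum_{y\in Rx}\omega(y)=|Rx|$ for $x\ne0$; $\mathcal P_{\rm hom}$ partitions $R$ by equal weight. For a partition $\mathcal P$ of $R$, the right $\chi$-dual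 is given by $a\sim a'$ iff $\sum_{b\in P}\chi(ab)=\sum_{b\in P}\chi(a'b)$ for all blocks $P$; left dual uses $\chi(ba)$. $\mathcal P$ is reflexive if the left $\chi$-dual of its right $\chi$-dual equals $\mathcal P$ (equivalently, $\mathcal P$ and its right dual have equally many blocks), and self-dual if it equals its right $\chi$-dual. *)

theory Defs
  imports Complex_Main "HOL-Algebra.Algebra"
begin

definition left_ideal :: "('a, 'm) ring_scheme \<Rightarrow> 'a set \<Rightarrow> bool" where
  "left_ideal R I \<longleftrightarrow> I \<subseteq> carrier R \<and> \<zero>\<^bsub>R\<^esub> \<in> I
     \<and> (\<forall>x\<in>I. \<forall>y\<in>I. x \<oplus>\<^bsub>R\<^esub> y \<in> I) \<and> (\<forall>x\<in>I. \<ominus>\<^bsub>R\<^esub> x \<in> I)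
     \<and> (\<forall>r\<in>carrier R. \<forall>x\<in>I. r \<otimes>\<^bsub>R\<^esub> x \<in> I)"

definition maximal_left_ideal :: "('a, 'm) ring_scheme \<Rightarrow> 'a set \<Rightarrow> bool" where
  "maximal_left_ideal R I \<longleftrightarrow> left_ideal R I \<and> I \<noteq> carrier R
     \<and> (\<forall>J. left_ideal R J \<and> I \<subseteq> J \<and> J \<noteq> carrier R \<longrightarrow> J = I)"

definition minimal_left_ideal :: "('a, 'm) ring_scheme \<Rightarrow> 'a set \<Rightarrow> bool" where
  "minimal_left_ideal R I \<longleftrightarrow> left_ideal R I \<and> I \<noteq> {\<zero>\<^bsub>R\<^esub>}
     \<and> (\<forall>J. left_ideal R J \<and> J \<subseteq> I \<and> J \<noteq> {\<zero>\<^bsub>R\<^esub>} \<longrightarrow> J = I)"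

definition jrad :: "('a, 'm) ring_scheme \<Rightarrow> 'a set" where
  "jrad R = carrier R \<inter> \<Inter>{I. maximal_left_ideal R I}"

text \<open>Socle: sum of all minimal left ideals (= smallest left ideal containing them).\<close>
definition lsoc :: "('a, 'm) ring_scheme \<Rightarrow> 'a set" where
  "lsoc R = \<Inter>{J. left_ideal R J \<and> (\<forall>I. minimal_left_ideal R I \<longrightarrow> I \<subseteq> J)}"

definition local_ring :: "('a, 'm) ring_scheme \<Rightarrow> bool" where
  "local_ring R \<longleftrightarrow> (\<exists>!I. maximal_left_ideal R I)"

definition add_chars :: "('a, 'm) ring_scheme \<Rightarrow> ('a \<Rightarrow> complex) set" where
  "add_chars R = {f \<in> extensional (carrier R). (\<forall>x\<in>carrier R. f x \<noteq> 0)
      \<and> (\<forall>x\<in>carrier R. \<forall>y\<in>carrier R. f (x \<oplus>\<^bsub>R\<^esub> y) = f x * f y)}"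

definition generating_char :: "('a, 'm) ring_scheme \<Rightarrow> ('a \<Rightarrow> complex) \<Rightarrow> bool" where
  "generating_char R \<chi> \<longleftrightarrow> \<chi> \<in> add_chars R
     \<and> bij_betw (\<lambda>r. restrict (\<lambda>x. \<chi> (x \<otimes>\<^bsub>R\<^esub> r)) (carrier R)) (carrier R) (add_chars R)"

definition frobenius :: "('a, 'm) ring_scheme \<Rightarrow> bool" where
  "frobenius R \<longleftrightarrow> (\<exists>\<chi>. generating_char R \<chi>)"

definition is_hom_weight :: "('a, 'm) ring_scheme \<Rightarrow> ('a \<Rightarrow> rat) \<Rightarrow> bool" where
  "is_hom_weight R w \<longleftrightarrow> w \<in> extensional (carrier R) \<and> w \<zero>\<^bsub>R\<^esub> = 0
     \<and> (\<forall>x\<in>carrier R. \<forall>y\<in>carrier R.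
          (\<lambda>r. r \<otimes>\<^bsub>R\<^esub> x) ` carrier R = (\<lambda>r. r \<otimes>\<^bsub>R\<^esub> y) ` carrier R \<longrightarrow> w x = w y)
     \<and> (\<forall>x\<in>carrier R. x \<noteq> \<zero>\<^bsub>R\<^esub> \<longrightarrow>
          (\<Sum>y\<in>(\<lambda>r. r \<otimes>\<^bsub>R\<^esub> x) ` carrier R. w y) = of_nat (card ((\<lambda>r. r \<otimes>\<^bsub>R\<^esub> x) ` carrier R)))"

definition hom_weight :: "('a, 'm) ring_scheme \<Rightarrow> 'a \<Rightarrow> rat" where
  "hom_weight R = (THE w. is_hom_weight R w)"

definition P_hom :: "('a, 'm) ring_scheme \<Rightarrow> 'a set set" where
  "P_hom R = (\<lambda>x. {y \<in> carrier R. hom_weight R y = hom_weight R x}) ` carrier R"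

definition right_dual :: "('a, 'm) ring_scheme \<Rightarrow> ('a \<Rightarrow> complex) \<Rightarrow> 'a set set \<Rightarrow> 'a set set" where
  "right_dual R \<chi> P = (\<lambda>a. {a' \<in> carrier R. \<forall>B\<in>P.
       (\<Sum>b\<in>B. \<chi> (a \<otimes>\<^bsub>R\<^esub> b)) = (\<Sum>b\<in>B. \<chi> (a' \<otimes>\<^bsub>R\<^esub> b))}) ` carrier R"

definition left_dual :: "('a, 'm) ring_scheme \<Rightarrow> ('a \<Rightarrow> complex) \<Rightarrow> 'a set set \<Rightarrow> 'a set set" where
  "left_dual R \<chi> P = (\<lambda>a. {a' \<in> carrier R. \<forall>B\<in>P.
       (\<Sum>b\<in>B. \<chi> (b \<otimes>\<^bsub>R\<^esub> a)) = (\<Sum>b\<in>B. \<chi> (b \<otimes>\<^bsub>R\<^esub> a'))}) ` carrier R"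

definition reflexive_partition :: "('a, 'm) ring_scheme \<Rightarrow> ('a \<Rightarrow> complex) \<Rightarrow> 'a set set \<Rightarrow> bool" where
  "reflexive_partition R \<chi> P \<longleftrightarrow> left_dual R \<chi> (right_dual R \<chi> P) = P"

definition self_dual_partition :: "('a, 'm) ring_scheme \<Rightarrow> ('a \<Rightarrow> complex) \<Rightarrow> 'a set set \<Rightarrow> bool" where
  "self_dual_partition R \<chi> P \<longleftrightarrow> right_dual R \<chi> P = P"

text \<open>Components are indexed by (i,j) with i < t, j < n i; elements of the product are
  functions a with a i j the (i,j)-component, and undefined outside the index range.\<close>

definition in_idx :: "nat \<Rightarrow> (nat \<Rightarrow> nat) \<Rightarrow> nat \<Rightarrow> nat \<Rightarrow> bool" where
  "in_idx t n i j \<longleftrightarrow> i < t \<and> j < n i"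

definition prod_ring :: "nat \<Rightarrow> (nat \<Rightarrow> nat) \<Rightarrow> (nat \<Rightarrow> nat \<Rightarrow> ('c, 'm) ring_scheme)
    \<Rightarrow> (nat \<Rightarrow> nat \<Rightarrow> 'c) ring" where
  "prod_ring t n S = \<lparr>carrier = {a. \<forall>i j. (in_idx t n i j \<longrightarrow> a i j \<in> carrier (S i j))
                                  \<and> (\<not> in_idx t n i j \<longrightarrow> a i j = undefined)},
     monoid.mult = (\<lambda>a b i j. if in_idx t n i j then a i j \<otimes>\<^bsub>S i j\<^esub> b i j else undefined),
     one = (\<lambda>i j. if in_idx t n i j then \<one>\<^bsub>S i j\<^esub> else undefined),
     ring.zero = (\<lambda>i j. if in_idx t n i j then \<zero>\<^bsub>S i j\<^esub> else undefined),
     ring.add = (\<lambda>a b i j. if in_idx t n i j then a i j \<oplus>\<^bsub>S i j\<^esub> b i j else undefined)\<rparr>"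

text \<open>The index set M, as functions m with m i \<le> n i for i < t (values at i \<ge> t irrelevant).\<close>
definition in_M :: "nat \<Rightarrow> (nat \<Rightarrow> nat) \<Rightarrow> (nat \<Rightarrow> nat) \<Rightarrow> bool" where
  "in_M t n m \<longleftrightarrow> (\<forall>i<t. m i \<le> n i)"

definition separating :: "nat \<Rightarrow> (nat \<Rightarrow> nat) \<Rightarrow> (nat \<Rightarrow> nat) \<Rightarrow> bool" where
  "separating t n q \<longleftrightarrow> (\<forall>m l. in_M t n m \<longrightarrow> in_M t n l \<longrightarrow> (\<exists>i<t. m i \<noteq> l i) \<longrightarrow>
      (\<Prod>i<t. (int (q i) - 1) ^ m i) \<noteq> (\<Prod>i<t. (int (q i) - 1) ^ l i)
      \<or> (\<Sum>i<t. m i) mod 2 \<noteq> (\<Sum>i<t. l i) mod 2)"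

definition wt :: "(nat \<Rightarrow> nat) \<Rightarrow> (nat \<Rightarrow> nat \<Rightarrow> ('c, 'm) ring_scheme) \<Rightarrow> (nat \<Rightarrow> nat \<Rightarrow> 'c) \<Rightarrow> nat \<Rightarrow> nat" where
  "wt n S a i = card {j. j < n i \<and> a i j \<noteq> \<zero>\<^bsub>S i j\<^esub>}"

definition H' :: "nat \<Rightarrow> (nat \<Rightarrow> nat) \<Rightarrow> (nat \<Rightarrow> nat \<Rightarrow> ('c, 'm) ring_scheme) \<Rightarrow> (nat \<Rightarrow> nat \<Rightarrow> 'c) set set" where
  "H' t n S = {B. B \<noteq> {} \<and>
      (B = carrier (prod_ring t n S) - lsoc (prod_ring t n S)
       \<or> (\<exists>m. in_M t n m \<and> B = {a \<in> lsoc (prod_ring t n S). \<forall>i<t. wt n S a i = m i}))}"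

definition H'_dual :: "nat \<Rightarrow> (nat \<Rightarrow> nat) \<Rightarrow> (nat \<Rightarrow> nat \<Rightarrow> ('c, 'm) ring_scheme) \<Rightarrow> (nat \<Rightarrow> nat \<Rightarrow> 'c) set set" where
  "H'_dual t n S = {B. B \<noteq> {} \<and>
      (B = jrad (prod_ring t n S) - {\<zero>\<^bsub>prod_ring t n S\<^esub>}
       \<or> B = {\<zero>\<^bsub>prod_ring t n S\<^esub>}
       \<or> (\<exists>m. in_M t n m \<and> (\<exists>i<t. m i \<noteq> 0) \<and>
            B = {a \<in> carrier (prod_ring t n S) - jrad (prod_ring t n S).
                   \<forall>i<t. card {j. j < n i \<and> a i j \<notin> jrad (S i j)} = m i}))}"

definition hamming_prod :: "nat \<Rightarrow> (nat \<Rightarrow> nat) \<Rightarrow> (nat \<Rightarrow> nat \<Rightarrow> ('c, 'm) ring_scheme) \<Rightarrow> (nat \<Rightarrow> nat \<Rightarrow> 'c) set set" where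
  "hamming_prod t n S = {B. B \<noteq> {} \<and>
      (\<exists>m. in_M t n m \<and> B = {a \<in> carrier (prod_ring t n S). \<forall>i<t. wt n S a i = m i})}"

end

theory Submission
  imports Defs
begin

text \<open>
  In a finite local ring whose left socle has as many elements as the residue field, the socle is
  contained in every nonzero left ideal. Hence the function that is \<open>1\<close> at \<open>0\<close>,
  \<open>-1/(q - 1)\<close> on the rest of the socle and \<open>0\<close> elsewhere sums to zero over every nonzero
  left ideal. The product of these functions over all components is \<open>1 - \<omega>\<close> for the
  homogeneous weight \<open>\<omega>\<close>; on the socle its value is
  \<open>\<Prod>\<^sub>i (-1/(q\<^sub>i - 1))\<^bsup>m\<^sub>i\<^esup>\<close>, from which a separating list recovers the \<open>m\<^sub>i\<close>.

  For the duals, a generating character is a product of characters of the components, so the character sums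
  over the blocks are products of Krawtchouk values. They depend only on the numbers of
  nonradical (respectively nonzero) components, and already the blocks of weight one determine these numbers.
\<close>


section \<open>Finite local rings with simple socle\<close>

text \<open>All notions here are one-sided: ideals, radical and socle are built from left ideals,
  and a generating character is by definition nondegenerate in one argument only, whereas the two
  duals multiply on opposite sides. Three finiteness arguments restore the symmetry: one-sided
  inverses are two-sided, so the radical absorbs multiplication on the right; the socle lies in
  every nonzero left ideal, so socle times radical vanishes just as radical times socle does; and a
  double count of character sums gives nondegeneracy in the other argument.

  Weight-one blocks suffice because their Krawtchouk value is affine in the number of counted
  positions, with slope \<open>-q\<^sub>i\<close>. One more bit is needed in each direction. In the
  dual of \<open>H'\<close>, the sum over the complement of the socle tells 0 from the rest of the
  radical; in the dual of \<open>H'_dual\<close>, the sum over the nonzero radical elements detects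
  membership in the socle. Reflexivity comes from computing this second dual explicitly, not from
  counting blocks.\<close>

lemma (in ring) sum_character_eq_0:
  fixes g :: "'a \<Rightarrow> complex"
  assumes fin: "finite A" and sub: "A \<subseteq> carrier R"
    and closed: "\<And>x y. x \<in> A \<Longrightarrow> y \<in> A \<Longrightarrow> x \<oplus> y \<in> A"
    and hom: "\<And>x y. x \<in> A \<Longrightarrow> y \<in> A \<Longrightarrow> g (x \<oplus> y) = g x * g y"
    and c: "c \<in> A" "g c \<noteq> 1"
  shows "(\<Sum>x\<in>A. g x) = 0"
proof -
  \<comment> \<open>Translation by \<open>c\<close> permutes \<open>A\<close> and multiplies the sum
    by \<open>g c\<close>, which differs from 1.\<close>
  have inj: "inj_on (\<lambda>x. c \<oplus> x) A"
    using sub c(1) by (auto intro!: inj_onI simp: subset_iff)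
  have "(\<lambda>x. c \<oplus> x) ` A = A"
    by (rule endo_inj_surj[OF fin _ inj]) (use closed c(1) in auto)
  then have "(\<Sum>x\<in>A. g x) = (\<Sum>x\<in>A. g (c \<oplus> x))"
    using sum.reindex[OF inj, of g] by simp
  also have "\<dots> = g c * (\<Sum>x\<in>A. g x)"
    using hom c(1) by (simp add: sum_distrib_left)
  finally show ?thesis using c(2) by simp
qed

lemma (in ring) left_ideal_carrier: "left_ideal R (carrier R)"
  by (auto simp: left_ideal_def)

lemma (in ring) left_ideal_principal:
  assumes "x \<in> carrier R"
  shows "left_ideal R ((\<lambda>r. r \<otimes> x) ` carrier R)"
proof -
  have 1: "\<zero> \<in> (\<lambda>r. r \<otimes> x) ` carrier R"
    by (rule image_eqI[of _ _ \<zero>]) (use assms in auto)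
  have 2: "r \<otimes> x \<oplus> s \<otimes> x = (r \<oplus> s) \<otimes> x" "\<ominus> (r \<otimes> x) = (\<ominus> r) \<otimes> x" "r \<otimes> (s \<otimes> x) = (r \<otimes> s) \<otimes> x"
    if "r \<in> carrier R" "s \<in> carrier R" for r s
    using assms that by (simp_all add: l_distr l_minus m_assoc)
  show ?thesis unfolding left_ideal_def
    using assms 1 by (auto simp: 2 intro!: imageI)
qed

lemma (in ring) mem_principal:
  assumes "x \<in> carrier R" shows "x \<in> (\<lambda>r. r \<otimes> x) ` carrier R"
  by (rule image_eqI[of _ _ \<one>]) (use assms in auto)

lemma left_ideal_principal_subset:
  "left_ideal R I \<Longrightarrow> x \<in> I \<Longrightarrow> (\<lambda>r. r \<otimes>\<^bsub>R\<^esub> x) ` carrier R \<subseteq> I"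
  by (rule image_subsetI) (simp add: left_ideal_def)

lemma left_ideal_closed:
  assumes "left_ideal R I"
  shows "x \<in> I \<Longrightarrow> x \<in> carrier R" "\<zero>\<^bsub>R\<^esub> \<in> I" "x \<in> I \<Longrightarrow> y \<in> I \<Longrightarrow> x \<oplus>\<^bsub>R\<^esub> y \<in> I"
    "r \<in> carrier R \<Longrightarrow> x \<in> I \<Longrightarrow> r \<otimes>\<^bsub>R\<^esub> x \<in> I"
  using assms unfolding left_ideal_def by (blast, simp_all)

text \<open>Serves \<open>lsoc_mult_jrad\<close>: for \<open>r\<close> in the radical this ideal
  turns out to be nonzero and hence to contain the socle.\<close>

lemma (in ring) left_ideal_annihilator:
  assumes "r \<in> carrier R"
  shows "left_ideal R {y \<in> carrier R. y \<otimes> r = \<zero>}"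
  using assms by (auto simp: left_ideal_def l_distr l_minus m_assoc)

lemma (in ring) left_ideal_one: "left_ideal R I \<Longrightarrow> \<one> \<in> I \<Longrightarrow> I = carrier R"
  using left_ideal_principal_subset[of R I \<one>] by (simp add: left_ideal_def subset_antisym)

text \<open>In a finite ring one-sided inverses are two-sided, because an injective multiplication map is onto.\<close>

lemma (in ring) left_inverse_imp_right_inverse:
  assumes fin: "finite (carrier R)" and xy: "x \<in> carrier R" "y \<in> carrier R" "y \<otimes> x = \<one>"
  shows "x \<otimes> y = \<one>"
proof -
  have "inj_on (\<lambda>r. x \<otimes> r) (carrier R)"
  proof (rule inj_onI)
    fix a b assume ab: "a \<in> carrier R" "b \<in> carrier R" "x \<otimes> a = x \<otimes> b"
    then have "y \<otimes> (x \<otimes> a) = y \<otimes> (x \<otimes> b)" by simp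
    then show "a = b" using ab(1,2) xy by (simp flip: m_assoc)
  qed
  then have "(\<lambda>r. x \<otimes> r) ` carrier R = carrier R"
    by (intro endo_inj_surj fin) (use xy in auto)
  then obtain z where z: "z \<in> carrier R" "x \<otimes> z = \<one>"
    using one_closed by (metis (no_types, lifting) imageE)
  have "y = y \<otimes> (x \<otimes> z)" using xy z by simp
  also have "\<dots> = z" using xy z(1) by (simp flip: m_assoc)
  finally show ?thesis using z by simp
qed

lemma (in ring) ex_maximal_left_ideal:
  assumes fin: "finite (carrier R)" and I: "left_ideal R I" "I \<noteq> carrier R"
  obtains J where "maximal_left_ideal R J" "I \<subseteq> J"
proof -
  let ?F = "{J. left_ideal R J \<and> J \<noteq> carrier R \<and> I \<subseteq> J}"
  have "finite ?F"
    by (rule finite_subset[of _ "Pow (carrier R)"]) (auto simp: left_ideal_def fin)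
  moreover have "I \<in> ?F" using I by auto
  ultimately obtain J where J: "J \<in> ?F" "\<forall>K\<in>?F. J \<subseteq> K \<longrightarrow> J = K"
    using finite_has_maximal2[of ?F I] by blast
  have "maximal_left_ideal R J" unfolding maximal_left_ideal_def using J by blast
  then show ?thesis using J that by auto
qed

lemma (in ring) ex_minimal_left_ideal:
  assumes fin: "finite (carrier R)" and I: "left_ideal R I" "I \<noteq> {\<zero>}"
  obtains J where "minimal_left_ideal R J" "J \<subseteq> I"
proof -
  let ?F = "{J. left_ideal R J \<and> J \<noteq> {\<zero>} \<and> J \<subseteq> I}"
  have "finite ?F"
    by (rule finite_subset[of _ "Pow (carrier R)"]) (auto simp: left_ideal_def fin)
  moreover have "I \<in> ?F" using I by auto
  ultimately obtain J where J: "J \<in> ?F" "\<forall>K\<in>?F. K \<subseteq> J \<longrightarrow> J = K"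
    using finite_has_minimal2[of ?F I] by blast
  have "minimal_left_ideal R J" unfolding minimal_left_ideal_def using J by blast
  then show ?thesis using J that by auto
qed

section \<open>Radical and socle of a finite local ring\<close>

locale finite_local_ring = ring R for R (structure) +
  assumes finite_carrier: "finite (carrier R)"
    and unique_maximal: "local_ring R"
begin

lemma jrad_maximal: "maximal_left_ideal R (jrad R)"
proof -
  obtain I where I: "maximal_left_ideal R I" "\<And>J. maximal_left_ideal R J \<Longrightarrow> J = I"
    using unique_maximal unfolding local_ring_def by auto
  then have "{J. maximal_left_ideal R J} = {I}" by blast
  then have "jrad R = carrier R \<inter> I" unfolding jrad_def by simp
  moreover have "I \<subseteq> carrier R" using I(1) by (simp add: maximal_left_ideal_def left_ideal_def)
  ultimately show ?thesis using I(1) by (simp add: Int_absorb1)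
qed

lemma jrad_left_ideal: "left_ideal R (jrad R)"
  and jrad_proper: "jrad R \<noteq> carrier R"
  using jrad_maximal by (auto simp: maximal_left_ideal_def)

lemma jrad_closed: "x \<in> jrad R \<Longrightarrow> x \<in> carrier R"
  by (rule left_ideal_closed(1)[OF jrad_left_ideal])

lemma proper_left_ideal_subset_jrad:
  assumes "left_ideal R I" "I \<noteq> carrier R" shows "I \<subseteq> jrad R"
proof -
  obtain J where "maximal_left_ideal R J" "I \<subseteq> J"
    using ex_maximal_left_ideal[OF finite_carrier assms] .
  then show ?thesis using jrad_maximal unique_maximal unfolding local_ring_def by blast
qed

lemma one_notin_jrad: "\<one> \<notin> jrad R"
  using left_ideal_one jrad_left_ideal jrad_proper by blast

lemma one_neq_zero: "\<one> \<noteq> \<zero>"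
  using one_notin_jrad left_ideal_closed(2)[OF jrad_left_ideal] by metis

text \<open>The left ideal generated by \<open>x\<close> is not inside the radical, so it is not
  proper and contains 1. This gives a left inverse, and finiteness makes it two-sided.\<close>

lemma inverse_if_notin_jrad:
  assumes x: "x \<in> carrier R" "x \<notin> jrad R"
  shows "\<exists>y\<in>carrier R. y \<otimes> x = \<one> \<and> x \<otimes> y = \<one>"
proof -
  have "(\<lambda>r. r \<otimes> x) ` carrier R = carrier R"
    using proper_left_ideal_subset_jrad[OF left_ideal_principal[OF x(1)]] mem_principal[OF x(1)] x(2)
    by blast
  then obtain y where "y \<in> carrier R" "y \<otimes> x = \<one>"
    using one_closed by (metis (no_types, lifting) imageE)
  then show ?thesis using left_inverse_imp_right_inverse[OF finite_carrier x(1)] by blast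
qed

text \<open>Otherwise \<open>x \<otimes> r\<close> would have an inverse \<open>y\<close>, and the
  right inverse \<open>r \<otimes> y\<close> of \<open>x\<close> would also be a left inverse,
  putting 1 into the radical.\<close>

lemma jrad_mult_right:
  assumes x: "x \<in> jrad R" and r: "r \<in> carrier R"
  shows "x \<otimes> r \<in> jrad R"
proof (rule ccontr)
  assume n: "x \<otimes> r \<notin> jrad R"
  note xc = jrad_closed[OF x]
  obtain y where y: "y \<in> carrier R" "(x \<otimes> r) \<otimes> y = \<one>"
    using inverse_if_notin_jrad[OF _ n] xc r by auto
  then have "(r \<otimes> y) \<otimes> x = \<one>"
    using left_inverse_imp_right_inverse[OF finite_carrier, of "r \<otimes> y" x] xc r by (simp add: m_assoc)
  then have "\<one> \<in> jrad R" using left_ideal_closed(4)[OF jrad_left_ideal _ x, of "r \<otimes> y"] r y by simp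
  then show False using one_notin_jrad by simp
qed

text \<open>Nakayama's argument for a single element: \<open>\<one> \<ominus> r\<close> is
  invertible and kills \<open>x\<close>.\<close>

lemma jrad_fixed_imp_zero:
  assumes r: "r \<in> jrad R" and x: "x \<in> carrier R" "r \<otimes> x = x"
  shows "x = \<zero>"
proof -
  note rc = jrad_closed[OF r]
  have "\<one> \<ominus> r \<notin> jrad R"
  proof
    assume "\<one> \<ominus> r \<in> jrad R"
    then have "(\<one> \<ominus> r) \<oplus> r \<in> jrad R" by (rule left_ideal_closed(3)[OF jrad_left_ideal _ r])
    moreover have "(\<one> \<ominus> r) \<oplus> r = \<one>" using rc by algebra
    ultimately show False using one_notin_jrad by simp
  qed
  then obtain y where y: "y \<in> carrier R" "y \<otimes> (\<one> \<ominus> r) = \<one>"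
    using inverse_if_notin_jrad[of "\<one> \<ominus> r"] rc by auto
  have "(\<one> \<ominus> r) \<otimes> x = x \<ominus> r \<otimes> x"
    using rc x(1) by (simp add: minus_eq l_distr l_minus)
  then have 0: "(\<one> \<ominus> r) \<otimes> x = \<zero>" using x by (simp add: minus_eq r_neg)
  have "x = (y \<otimes> (\<one> \<ominus> r)) \<otimes> x" using y x by simp
  also have "\<dots> = y \<otimes> ((\<one> \<ominus> r) \<otimes> x)" using y(1) rc x(1) by (simp add: m_assoc)
  finally show ?thesis using 0 y by simp
qed

text \<open>Closure under left multiplication is the point where the radical must absorb factors on
  its right.\<close>

lemma left_ideal_annihilated_by_jrad: "left_ideal R {x \<in> carrier R. \<forall>r\<in>jrad R. r \<otimes> x = \<zero>}"
  unfolding left_ideal_def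
proof (intro conjI ballI)
  fix s x assume sx: "s \<in> carrier R" "x \<in> {x \<in> carrier R. \<forall>r\<in>jrad R. r \<otimes> x = \<zero>}"
  have "r \<otimes> (s \<otimes> x) = \<zero>" if r: "r \<in> jrad R" for r
  proof -
    have "r \<otimes> (s \<otimes> x) = (r \<otimes> s) \<otimes> x" using sx jrad_closed[OF r] by (simp add: m_assoc)
    then show ?thesis using sx jrad_mult_right[OF r sx(1)] by simp
  qed
  then show "s \<otimes> x \<in> {x \<in> carrier R. \<forall>r\<in>jrad R. r \<otimes> x = \<zero>}" using sx by simp
qed (auto simp: r_distr r_minus jrad_closed)

text \<open>If \<open>r \<otimes> x\<close> were nonzero, it would generate \<open>I\<close> by
  minimality, so \<open>x\<close> would be a multiple of \<open>r \<otimes> x\<close>. Then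
  \<open>x\<close> is fixed by the radical element \<open>s \<otimes> r\<close> and must
  vanish.\<close>

lemma minimal_left_ideal_annihilated:
  assumes I: "minimal_left_ideal R I" and x: "x \<in> I" and r: "r \<in> jrad R"
  shows "r \<otimes> x = \<zero>"
proof (rule ccontr)
  assume nz: "r \<otimes> x \<noteq> \<zero>"
  have li: "left_ideal R I" using I by (simp add: minimal_left_ideal_def)
  then have xc: "x \<in> carrier R" using x by (rule left_ideal_closed(1))
  note rc = jrad_closed[OF r]
  have lr: "left_ideal R ((\<lambda>s. s \<otimes> (r \<otimes> x)) ` carrier R)"
    using left_ideal_principal rc xc by simp
  have mem: "r \<otimes> x \<in> (\<lambda>s. s \<otimes> (r \<otimes> x)) ` carrier R" using mem_principal rc xc by simp
  have "r \<otimes> x \<in> I" by (rule left_ideal_closed(4)[OF li rc x])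
  then have "(\<lambda>s. s \<otimes> (r \<otimes> x)) ` carrier R \<subseteq> I"
    by (rule left_ideal_principal_subset[OF li])
  then have "(\<lambda>s. s \<otimes> (r \<otimes> x)) ` carrier R = I"
    using I lr mem nz unfolding minimal_left_ideal_def by blast
  then obtain s where s: "s \<in> carrier R" "x = s \<otimes> (r \<otimes> x)" using x by blast
  have "s \<otimes> r \<in> jrad R" by (rule left_ideal_closed(4)[OF jrad_left_ideal s(1) r])
  then have "x = \<zero>"
    by (rule jrad_fixed_imp_zero) (use s rc xc in \<open>simp_all add: m_assoc\<close>)
  then show False using nz rc by simp
qed

text \<open>The inclusion from right to left holds because a nonzero \<open>x\<close> killed by the
  radical generates a minimal left ideal: if a multiple \<open>s \<otimes> x\<close> is nonzero,
  then \<open>s\<close> is a unit and \<open>x\<close> is recovered from it.\<close>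

lemma lsoc_eq: "lsoc R = {x \<in> carrier R. \<forall>r\<in>jrad R. r \<otimes> x = \<zero>}" (is "_ = ?A")
proof
  have "I \<subseteq> ?A" if "minimal_left_ideal R I" for I
  proof
    fix x assume x: "x \<in> I"
    have "left_ideal R I" using that by (simp add: minimal_left_ideal_def)
    then have "x \<in> carrier R" using x by (rule left_ideal_closed(1))
    then show "x \<in> ?A" using minimal_left_ideal_annihilated[OF that x] by simp
  qed
  then show "lsoc R \<subseteq> ?A" using left_ideal_annihilated_by_jrad unfolding lsoc_def by blast
next
  show "?A \<subseteq> lsoc R"
  proof
    fix x assume x: "x \<in> ?A"
    show "x \<in> lsoc R" unfolding lsoc_def
    proof safe
      fix J assume J: "left_ideal R J" "\<forall>I. minimal_left_ideal R I \<longrightarrow> I \<subseteq> J"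
      show "x \<in> J"
      proof (cases "x = \<zero>")
        case True then show ?thesis using left_ideal_closed(2)[OF J(1)] by simp
      next
        case False
        let ?P = "(\<lambda>r. r \<otimes> x) ` carrier R"
        have xc: "x \<in> carrier R" using x by simp
        have "K = ?P" if K: "left_ideal R K" "K \<subseteq> ?P" "K \<noteq> {\<zero>}" for K
        proof -
          obtain y where y: "y \<in> K" "y \<noteq> \<zero>" using K(3) left_ideal_closed(2)[OF K(1)] by fast
          then obtain s where s: "s \<in> carrier R" "y = s \<otimes> x" using K by blast
          then have "s \<notin> jrad R" using x y by auto
          then obtain u where u: "u \<in> carrier R" "u \<otimes> s = \<one>"
            using inverse_if_notin_jrad s by metis
          have "u \<otimes> y = x" using u s xc by (simp flip: m_assoc)
          then have "x \<in> K" using left_ideal_closed(4)[OF K(1) u(1) y(1)] by simp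
          then show ?thesis using left_ideal_principal_subset[OF K(1)] K(2) by blast
        qed
        moreover have "?P \<noteq> {\<zero>}" using mem_principal[OF xc] False by auto
        ultimately have "minimal_left_ideal R ?P"
          unfolding minimal_left_ideal_def using left_ideal_principal[OF xc] by blast
        then show ?thesis using J mem_principal[OF xc] by blast
      qed
    qed
  qed
qed

lemma lsoc_left_ideal: "left_ideal R (lsoc R)"
  unfolding lsoc_eq by (rule left_ideal_annihilated_by_jrad)

text \<open>The fibres of right multiplication by \<open>x\<close> are exactly the cosets of the
  radical: radical elements kill \<open>x\<close>, and a unit cannot kill a nonzero element. So the
  left ideal is a copy of the residue ring.\<close>

lemma card_principal_lsoc:
  assumes x: "x \<in> lsoc R" "x \<noteq> \<zero>"
  shows "card ((\<lambda>r. r \<otimes> x) ` carrier R) = card (a_rcosets (jrad R))"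
proof -
  have xc: "x \<in> carrier R" and ann: "\<And>r. r \<in> jrad R \<Longrightarrow> r \<otimes> x = \<zero>" using x by (auto simp: lsoc_eq)
  let ?f = "\<lambda>y. {r \<in> carrier R. r \<otimes> x = y}"
  have fib: "?f (s \<otimes> x) = jrad R +> s" if s: "s \<in> carrier R" for s
  proof -
    have "r \<in> jrad R +> s" if r: "r \<in> carrier R" "r \<otimes> x = s \<otimes> x" for r
    proof -
      have 0: "(r \<ominus> s) \<otimes> x = \<zero>" using r s xc by (simp add: minus_eq l_distr l_minus r_neg)
      have "r \<ominus> s \<in> jrad R"
      proof (rule ccontr)
        assume "r \<ominus> s \<notin> jrad R"
        then obtain u where u: "u \<in> carrier R" "u \<otimes> (r \<ominus> s) = \<one>"
          using inverse_if_notin_jrad[of "r \<ominus> s"] r s by auto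
        have "x = (u \<otimes> (r \<ominus> s)) \<otimes> x" using u xc by simp
        also have "\<dots> = u \<otimes> ((r \<ominus> s) \<otimes> x)" using u(1) r s xc by (simp add: m_assoc)
        finally show False using 0 u x by simp
      qed
      moreover have "r = (r \<ominus> s) \<oplus> s" using r s by algebra
      ultimately show ?thesis unfolding a_r_coset_def' by blast
    qed
    moreover have "h \<oplus> s \<in> carrier R \<and> (h \<oplus> s) \<otimes> x = s \<otimes> x" if "h \<in> jrad R" for h
      using that ann jrad_closed s xc by (simp add: l_distr)
    ultimately show ?thesis unfolding a_r_coset_def' by fast
  qed
  have "?f ` (\<lambda>r. r \<otimes> x) ` carrier R = a_rcosets (jrad R)"
    unfolding image_image A_RCOSETS_def' using fib by auto
  moreover have "inj_on ?f ((\<lambda>r. r \<otimes> x) ` carrier R)"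
    by (rule inj_onI) blast
  then have "card (?f ` (\<lambda>r. r \<otimes> x) ` carrier R) = card ((\<lambda>r. r \<otimes> x) ` carrier R)"
    by (rule card_image)
  ultimately show ?thesis by simp
qed

end

text \<open>The cardinality condition forces the socle to be a single minimal left ideal, which
  explains the name.\<close>

locale simple_socle_ring = finite_local_ring R for R (structure) +
  assumes card_socle: "card (lsoc R) = card (a_rcosets (jrad R))"
begin

lemma lsoc_closed: "x \<in> lsoc R \<Longrightarrow> x \<in> carrier R"
  by (simp add: lsoc_eq)

text \<open>The left ideal generated by \<open>x\<close> lies in the socle and has as many elements
  as the residue ring, hence as the socle.\<close>

lemma lsoc_eq_principal:
  assumes x: "x \<in> lsoc R" "x \<noteq> \<zero>"
  shows "(\<lambda>r. r \<otimes> x) ` carrier R = lsoc R"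
proof (rule card_subset_eq)
  show "finite (lsoc R)" by (rule finite_subset[OF _ finite_carrier]) (auto simp: lsoc_eq)
qed (use card_principal_lsoc[OF x] card_socle left_ideal_principal_subset[OF lsoc_left_ideal x(1)] in auto)

text \<open>By finiteness \<open>I\<close> contains a minimal left ideal, and any nonzero element of
  that ideal is a socle element generating the whole socle.\<close>

lemma lsoc_subset_left_ideal:
  assumes "left_ideal R I" "I \<noteq> {\<zero>}"
  shows "lsoc R \<subseteq> I"
proof -
  obtain K where K: "minimal_left_ideal R K" "K \<subseteq> I"
    using ex_minimal_left_ideal[OF finite_carrier assms] .
  then have li: "left_ideal R K" "K \<noteq> {\<zero>}" by (auto simp: minimal_left_ideal_def)
  then obtain x where x: "x \<in> K" "x \<noteq> \<zero>" using left_ideal_closed(2)[OF li(1)] by blast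
  have "x \<in> lsoc R" using K(1) x(1) unfolding lsoc_def by blast
  from lsoc_eq_principal[OF this x(2)] left_ideal_principal_subset[OF li(1) x(1)] K(2)
  show ?thesis by simp
qed

lemma lsoc_nonzero: obtains x where "x \<in> lsoc R" "x \<noteq> \<zero>"
proof -
  obtain K where K: "minimal_left_ideal R K"
    using ex_minimal_left_ideal[OF finite_carrier left_ideal_carrier] one_neq_zero
    by (metis one_closed singletonD)
  then have "left_ideal R K" "K \<noteq> {\<zero>}" by (simp_all add: minimal_left_ideal_def)
  then obtain x where "x \<in> K" "x \<noteq> \<zero>" using left_ideal_closed(2) by blast
  moreover have "K \<subseteq> lsoc R" using K unfolding lsoc_def by blast
  ultimately show ?thesis using that by blast
qed

text \<open>Right-hand counterpart of the annihilation in \<open>lsoc_eq\<close>, needed for sums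
  over products \<open>y \<otimes> x\<close>. Right multiplication by \<open>r\<close> is not
  injective, since otherwise it would be onto and the radical would be the whole ring. So the
  annihilator of \<open>r\<close> is a nonzero left ideal and contains the socle.\<close>

lemma lsoc_mult_jrad:
  assumes x: "x \<in> lsoc R" and r: "r \<in> jrad R"
  shows "x \<otimes> r = \<zero>"
proof -
  note rc = jrad_closed[OF r]
  let ?K = "{y \<in> carrier R. y \<otimes> r = \<zero>}"
  have "?K \<noteq> {\<zero>}"
  proof
    assume K: "?K = {\<zero>}"
    have "inj_on (\<lambda>y. y \<otimes> r) (carrier R)"
    proof (rule inj_onI)
      fix a b assume ab: "a \<in> carrier R" "b \<in> carrier R" "a \<otimes> r = b \<otimes> r"
      then have "(a \<ominus> b) \<otimes> r = \<zero>" using rc by (simp add: minus_eq l_distr l_minus r_neg)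
      then have "a \<ominus> b \<in> ?K" using ab by simp
      then have "a \<ominus> b = \<zero>" using K by blast
      then show "a = b" using ab by simp
    qed
    then have "(\<lambda>y. y \<otimes> r) ` carrier R = carrier R"
      by (intro endo_inj_surj finite_carrier) (use rc in auto)
    then have "carrier R \<subseteq> jrad R"
      using left_ideal_principal_subset[OF jrad_left_ideal r] by simp
    then show False using one_notin_jrad by auto
  qed
  then show ?thesis using lsoc_subset_left_ideal[OF left_ideal_annihilator[OF rc]] x by blast
qed

lemma lsoc_mult_right: "x \<in> lsoc R \<Longrightarrow> r \<in> carrier R \<Longrightarrow> x \<otimes> r \<in> lsoc R"
  using jrad_closed by (simp add: lsoc_eq m_assoc[symmetric])

lemma card_lsoc_ge_2: "card (lsoc R) \<ge> 2"
proof -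
  obtain x where x: "x \<in> lsoc R" "x \<noteq> \<zero>" by (rule lsoc_nonzero)
  have "finite (lsoc R)" by (rule finite_subset[OF _ finite_carrier]) (auto simp: lsoc_eq)
  moreover have "{x, \<zero>} \<subseteq> lsoc R" using x left_ideal_closed(2)[OF lsoc_left_ideal] by simp
  ultimately show ?thesis using card_mono[of "lsoc R" "{x, \<zero>}"] x by simp
qed

lemma card_carrier: "card (carrier R) = card (jrad R) * card (lsoc R)"
proof -
  have "additive_subgroup (jrad R) R"
    using jrad_left_ideal left_ideal_closed(2)[OF jrad_left_ideal] unfolding left_ideal_def
    by (intro additive_subgroupI add.subgroupI) (blast | simp flip: a_inv_def)+
  then have "card (a_rcosets (jrad R)) * card (jrad R) = order R"
    by (intro a_lagrange finite_carrier)
  then show ?thesis by (simp add: order_def card_socle mult.commute)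
qed

end

section \<open>Sums over boxes and Krawtchouk values\<close>

abbreviation idx :: "nat \<Rightarrow> (nat \<Rightarrow> nat) \<Rightarrow> (nat \<times> nat) set" where
  "idx t n \<equiv> (SIGMA i:{..<t}. {..<n i})"

text \<open>One shape for the carrier, the radical, the socle and the principal left ideals of the
  product. The value \<open>undefined\<close> outside the index range agrees with
  \<open>prod_ring\<close>.\<close>

definition box :: "nat \<Rightarrow> (nat \<Rightarrow> nat) \<Rightarrow> (nat \<Rightarrow> nat \<Rightarrow> 'c set) \<Rightarrow> (nat \<Rightarrow> nat \<Rightarrow> 'c) set" where
  "box t n B = {a. \<forall>i j. (in_idx t n i j \<longrightarrow> a i j \<in> B i j) \<and> (\<not> in_idx t n i j \<longrightarrow> a i j = undefined)}"

lemma mem_box: "a \<in> box t n B \<longleftrightarrow>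
    (\<forall>i<t. \<forall>j<n i. a i j \<in> B i j) \<and> (\<forall>i j. \<not> in_idx t n i j \<longrightarrow> a i j = undefined)"
  by (auto simp: box_def in_idx_def)

text \<open>The distributive law, obtained by uncurrying the elements of the box to functions on
  index pairs.\<close>

lemma sum_box_prod:
  fixes g :: "nat \<Rightarrow> nat \<Rightarrow> 'c \<Rightarrow> 'r :: comm_semiring_1"
  assumes fin: "\<And>i j. i < t \<Longrightarrow> j < n i \<Longrightarrow> finite (B i j)"
  shows "(\<Sum>a\<in>box t n B. \<Prod>p\<in>idx t n. g (fst p) (snd p) (a (fst p) (snd p)))
       = (\<Prod>p\<in>idx t n. \<Sum>b\<in>B (fst p) (snd p). g (fst p) (snd p) b)"
proof -
  have "(\<Prod>p\<in>idx t n. \<Sum>b\<in>B (fst p) (snd p). g (fst p) (snd p) b)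
      = (\<Sum>f\<in>PiE (idx t n) (\<lambda>p. B (fst p) (snd p)). \<Prod>p\<in>idx t n. g (fst p) (snd p) (f p))"
    by (rule prod_sum_PiE) (auto simp: fin)
  also have "\<dots> = (\<Sum>a\<in>box t n B. \<Prod>p\<in>idx t n. g (fst p) (snd p) (a (fst p) (snd p)))"
    by (rule sum.reindex_bij_witness[of _ "\<lambda>a p. a (fst p) (snd p)" "\<lambda>f i j. f (i, j)"])
      (auto simp: mem_box PiE_iff extensional_def in_idx_def)
  finally show ?thesis by simp
qed

lemma finite_box:
  assumes "\<And>i j. i < t \<Longrightarrow> j < n i \<Longrightarrow> finite (B i j)"
  shows "finite (box t n B)"
proof (rule finite_surj)
  show "finite (PiE (idx t n) (\<lambda>p. B (fst p) (snd p)))"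
    by (rule finite_PiE) (use assms in auto)
  show "box t n B \<subseteq> (\<lambda>f i j. f (i, j)) ` PiE (idx t n) (\<lambda>p. B (fst p) (snd p))"
  proof
    fix a assume "a \<in> box t n B"
    then have "(\<lambda>p. a (fst p) (snd p)) \<in> PiE (idx t n) (\<lambda>p. B (fst p) (snd p))"
      by (auto simp: mem_box PiE_iff extensional_def in_idx_def)
    then show "a \<in> (\<lambda>f i j. f (i, j)) ` PiE (idx t n) (\<lambda>p. B (fst p) (snd p))"
      by (rule rev_image_eqI) simp
  qed
qed

text \<open>The possible sets of positions at which an element with weight profile \<open>m\<close>
  is nonzero, or nonradical, depending on the partition considered.\<close>

definition supports :: "nat \<Rightarrow> (nat \<Rightarrow> nat) \<Rightarrow> (nat \<Rightarrow> nat) \<Rightarrow> (nat \<times> nat) set set" where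
  "supports t n m = {U. U \<subseteq> idx t n \<and> (\<forall>i<t. card {j. (i, j) \<in> U} = m i)}"

lemma finite_supports: "finite (supports t n m)"
  by (rule finite_subset[of _ "Pow (idx t n)"]) (auto simp: supports_def)

text \<open>Grouping the block by the set of positions with entry in \<open>N\<close> turns it into
  a disjoint union of boxes, over each of which the sum factors. It is applied with \<open>Z\<close>
  zero and \<open>N\<close> the rest of the socle, and with \<open>Z\<close> the radical and
  \<open>N\<close> its complement.\<close>

lemma sum_weight_block:
  fixes g :: "nat \<Rightarrow> nat \<Rightarrow> 'c \<Rightarrow> 'r :: comm_semiring_1"
  assumes fin: "\<And>i j. i < t \<Longrightarrow> j < n i \<Longrightarrow> finite (Z i j) \<and> finite (N i j) \<and> Z i j \<inter> N i j = {}"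
  shows "(\<Sum>a\<in>{a \<in> box t n (\<lambda>i j. Z i j \<union> N i j). \<forall>i<t. card {j. j < n i \<and> a i j \<in> N i j} = m i}.
            \<Prod>p\<in>idx t n. g (fst p) (snd p) (a (fst p) (snd p)))
       = (\<Sum>U\<in>supports t n m. (\<Prod>p\<in>U. \<Sum>b\<in>N (fst p) (snd p). g (fst p) (snd p) b)
            * (\<Prod>p\<in>idx t n - U. \<Sum>b\<in>Z (fst p) (snd p). g (fst p) (snd p) b))"
    (is "sum ?F ?B = _")
proof -
  define supp where "supp a = {p \<in> idx t n. a (fst p) (snd p) \<in> N (fst p) (snd p)}" for a
  have row: "{j. (i, j) \<in> supp a} = {j. j < n i \<and> a i j \<in> N i j}" if "i < t" for a i
    using that by (auto simp: supp_def)
  have finB: "finite ?B"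
    by (rule finite_subset[OF _ finite_box[of t n "\<lambda>i j. Z i j \<union> N i j"]]) (use fin in auto)
  have sub: "supp ` ?B \<subseteq> supports t n m"
    by (auto simp: supports_def row) (auto simp: supp_def)
  have "sum ?F ?B = (\<Sum>U\<in>supports t n m. sum ?F {a \<in> ?B. supp a = U})"
    using sum.group[OF finB finite_supports sub, of ?F] by simp
  also have "\<dots> = (\<Sum>U\<in>supports t n m. (\<Prod>p\<in>U. \<Sum>b\<in>N (fst p) (snd p). g (fst p) (snd p) b)
            * (\<Prod>p\<in>idx t n - U. \<Sum>b\<in>Z (fst p) (snd p). g (fst p) (snd p) b))"
  proof (rule sum.cong[OF refl])
    fix U assume U: "U \<in> supports t n m"
    let ?C = "\<lambda>i j. if (i, j) \<in> U then N i j else Z i j"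
    have Usub: "U \<subseteq> idx t n" using U by (auto simp: supports_def)
    \<comment> \<open>Disjointness of \<open>Z\<close> and \<open>N\<close> ensures that an element
      of the box has support exactly \<open>U\<close> and not more.\<close>
    have "{a \<in> ?B. supp a = U} = box t n ?C"
    proof (intro equalityI subsetI)
      fix a assume a: "a \<in> {a \<in> ?B. supp a = U}"
      then have "\<forall>i<t. \<forall>j<n i. a i j \<in> Z i j \<union> N i j" "supp a = U"
        "\<forall>i j. \<not> in_idx t n i j \<longrightarrow> a i j = undefined"
        by (simp_all add: mem_box)
      then show "a \<in> box t n ?C" unfolding mem_box by (fastforce simp: supp_def)
    next
      fix a assume a: "a \<in> box t n ?C"
      have sU: "supp a = U"
      proof (intro equalityI subsetI)
        fix p assume "p \<in> supp a"
        then have p: "p \<in> idx t n" "a (fst p) (snd p) \<in> N (fst p) (snd p)" by (auto simp: supp_def)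
        then have lt: "fst p < t" "snd p < n (fst p)" by auto
        then have "Z (fst p) (snd p) \<inter> N (fst p) (snd p) = {}" using fin by simp
        moreover have "a (fst p) (snd p) \<in> ?C (fst p) (snd p)" using a lt unfolding mem_box by blast
        ultimately show "p \<in> U" using p(2) by (auto split: if_splits)
      next
        fix p assume "p \<in> U"
        then have "fst p < t" "snd p < n (fst p)" using Usub by auto
        moreover from this have "a (fst p) (snd p) \<in> ?C (fst p) (snd p)" using a unfolding mem_box by blast
        ultimately show "p \<in> supp a" using \<open>p \<in> U\<close> by (cases p) (simp add: supp_def)
      qed
      have "card {j. j < n i \<and> a i j \<in> N i j} = m i" if "i < t" for i
        using U that unfolding row[OF that, of a, unfolded sU, symmetric] by (simp add: supports_def)
      moreover have "a \<in> box t n (\<lambda>i j. Z i j \<union> N i j)"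
        using a by (auto simp: mem_box split: if_splits)
      ultimately show "a \<in> {a \<in> ?B. supp a = U}" using sU by simp
    qed
    then have "sum ?F {a \<in> ?B. supp a = U}
        = (\<Prod>p\<in>idx t n. \<Sum>b\<in>?C (fst p) (snd p). g (fst p) (snd p) b)"
      using sum_box_prod[of t n ?C g] fin by simp
    also have "\<dots> = (\<Prod>p\<in>U. \<Sum>b\<in>?C (fst p) (snd p). g (fst p) (snd p) b)
        * (\<Prod>p\<in>idx t n - U. \<Sum>b\<in>?C (fst p) (snd p). g (fst p) (snd p) b)"
      by (subst prod.subset_diff[OF Usub]) (auto simp: mult.commute)
    also have "\<dots> = (\<Prod>p\<in>U. \<Sum>b\<in>N (fst p) (snd p). g (fst p) (snd p) b)
            * (\<Prod>p\<in>idx t n - U. \<Sum>b\<in>Z (fst p) (snd p). g (fst p) (snd p) b)"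
      by (intro arg_cong2[of _ _ _ _ "(*)"] prod.cong refl) auto
    finally show "sum ?F {a \<in> ?B. supp a = U} = (\<Prod>p\<in>U. \<Sum>b\<in>N (fst p) (snd p). g (fst p) (snd p) b)
            * (\<Prod>p\<in>idx t n - U. \<Sum>b\<in>Z (fst p) (snd p). g (fst p) (snd p) b)" .
  qed
  finally show ?thesis .
qed

text \<open>If \<open>c i j\<close> takes only the values \<open>-1\<close> and \<open>q\<^sub>i - 1\<close>, this is a product of
  Krawtchouk polynomial values, one for each \<open>i\<close>.\<close>

definition krawtchouk :: "nat \<Rightarrow> (nat \<Rightarrow> nat) \<Rightarrow> (nat \<Rightarrow> nat) \<Rightarrow> (nat \<Rightarrow> nat \<Rightarrow> 'r) \<Rightarrow> 'r :: comm_semiring_1" where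
  "krawtchouk t n m c = (\<Sum>U\<in>supports t n m. \<Prod>p\<in>U. c (fst p) (snd p))"

text \<open>Marked and unmarked positions are matched separately, and the two bijections are
  glued.\<close>

lemma row_permutation:
  fixes P Q :: "nat \<Rightarrow> bool"
  assumes "card {j. j < k \<and> P j} = card {j. j < k \<and> Q j}"
  shows "\<exists>f. bij_betw f {..<k} {..<k} \<and> (\<forall>j<k. Q (f j) = P j)"
proof -
  have *: "{j. j < k \<and> \<not> R j} = {..<k} - {j. j < k \<and> R j}" for R by auto
  have "card {j. j < k \<and> \<not> P j} = card {j. j < k \<and> \<not> Q j}"
    unfolding * using assms by (simp add: card_Diff_subset subset_iff)
  then obtain h where h: "bij_betw h {j. j < k \<and> \<not> P j} {j. j < k \<and> \<not> Q j}"
    using finite_same_card_bij[of "{j. j < k \<and> \<not> P j}" "{j. j < k \<and> \<not> Q j}"] by auto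
  obtain g where g: "bij_betw g {j. j < k \<and> P j} {j. j < k \<and> Q j}"
    using finite_same_card_bij[of "{j. j < k \<and> P j}" "{j. j < k \<and> Q j}"] assms by auto
  let ?f = "\<lambda>j. if P j then g j else h j"
  have 1: "bij_betw ?f {j. j < k \<and> P j} {j. j < k \<and> Q j}"
    using g by (rule bij_betw_cong[THEN iffD1, rotated]) auto
  have 2: "bij_betw ?f {j. j < k \<and> \<not> P j} {j. j < k \<and> \<not> Q j}"
    using h by (rule bij_betw_cong[THEN iffD1, rotated]) auto
  have "{..<k} = {j. j < k \<and> R j} \<union> {j. j < k \<and> \<not> R j}" for R by auto
  then have "bij_betw ?f {..<k} {..<k}"
    using bij_betw_combine[OF 1 2] by fastforce
  moreover have "Q (?f j) = P j" if "j < k" for j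
    using bij_betw_apply[OF 1, of j] bij_betw_apply[OF 2, of j] that by auto
  ultimately show ?thesis by blast
qed

text \<open>Permutations within each row carry \<open>T\<close> to \<open>T'\<close>. They preserve
  the row counts of index sets, so they permute \<open>supports t n m\<close>, and the sum can be
  reindexed along them.\<close>

lemma krawtchouk_cong:
  fixes x y :: "nat \<Rightarrow> 'r :: comm_semiring_1"
  assumes rows: "\<And>i. i < t \<Longrightarrow> card {j. j < n i \<and> T i j} = card {j. j < n i \<and> T' i j}"
  shows "krawtchouk t n m (\<lambda>i j. if T i j then x i else y i)
       = krawtchouk t n m (\<lambda>i j. if T' i j then x i else y i)"
proof -
  have "\<forall>i\<in>{..<t}. \<exists>f. bij_betw f {..<n i} {..<n i} \<and> (\<forall>j<n i. T' i (f j) = T i j)"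
    using row_permutation[OF rows] by simp
  then obtain f where f: "\<And>i. i < t \<Longrightarrow> bij_betw (f i) {..<n i} {..<n i}"
      "\<And>i j. i < t \<Longrightarrow> j < n i \<Longrightarrow> T' i (f i j) = T i j"
    by (auto simp: bchoice_iff)
  define \<Phi> where "\<Phi> p = (fst p, f (fst p) (snd p))" for p
  have inj: "inj_on \<Phi> (idx t n)"
  proof (rule inj_onI)
    fix p r assume "p \<in> idx t n" "r \<in> idx t n" "\<Phi> p = \<Phi> r"
    then show "p = r"
      using f(1)[of "fst p"] by (cases p; cases r) (auto simp: \<Phi>_def bij_betw_def inj_on_def)
  qed
  have img: "\<Phi> ` idx t n = idx t n"
  proof (rule endo_inj_surj[OF _ _ inj])
    show "\<Phi> ` idx t n \<subseteq> idx t n" using bij_betw_apply[OF f(1)] by (auto simp: \<Phi>_def)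
  qed auto
  have card_row: "card {j. (i, j) \<in> \<Phi> ` U} = card {j. (i, j) \<in> U}" if "U \<subseteq> idx t n" "i < t" for U i
  proof -
    have "{j. (i, j) \<in> \<Phi> ` U} = f i ` {j. (i, j) \<in> U}" by (force simp: \<Phi>_def)
    moreover have "inj_on (f i) {j. (i, j) \<in> U}"
      by (rule inj_on_subset[OF bij_betw_imp_inj_on[OF f(1)[OF that(2)]]]) (use that in auto)
    ultimately show ?thesis by (simp add: card_image)
  qed
  have bij: "bij_betw (image \<Phi>) (supports t n m) (supports t n m)"
    unfolding bij_betw_def
  proof
    show "inj_on (image \<Phi>) (supports t n m)"
      by (rule inj_on_subset[OF inj_on_image_Pow[OF inj]]) (auto simp: supports_def)
    show "image \<Phi> ` supports t n m = supports t n m"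
    proof (intro equalityI subsetI)
      fix V assume "V \<in> image \<Phi> ` supports t n m"
      then obtain U where U: "U \<in> supports t n m" "V = \<Phi> ` U" by auto
      then show "V \<in> supports t n m" using card_row[of U] img by (auto simp: supports_def)
    next
      fix V assume V: "V \<in> supports t n m"
      then have "V \<subseteq> \<Phi> ` idx t n" using img by (auto simp: supports_def)
      then obtain U where U: "U \<subseteq> idx t n" "V = \<Phi> ` U" by (auto simp: subset_image_iff)
      then have "U \<in> supports t n m" using card_row[of U] V by (auto simp: supports_def)
      then show "V \<in> image \<Phi> ` supports t n m" using U by auto
    qed
  qed
  let ?g = "\<lambda>T p. if T (fst p) (snd p) then x (fst p) else y (fst p)"
  have "krawtchouk t n m (\<lambda>i j. if T' i j then x i else y i) = (\<Sum>U\<in>supports t n m. \<Prod>p\<in>\<Phi> ` U. ?g T' p)"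
    unfolding krawtchouk_def
    using sum.reindex_bij_betw[OF bij, of "\<lambda>U. \<Prod>p\<in>U. ?g T' p"] by simp
  also have "\<dots> = (\<Sum>U\<in>supports t n m. \<Prod>p\<in>U. ?g T p)"
  proof (rule sum.cong[OF refl])
    fix U assume "U \<in> supports t n m"
    then have U: "U \<subseteq> idx t n" by (simp add: supports_def)
    have "(\<Prod>p\<in>\<Phi> ` U. ?g T' p) = (\<Prod>p\<in>U. ?g T' (\<Phi> p))"
      using prod.reindex[OF inj_on_subset[OF inj U]] by simp
    also have "\<dots> = (\<Prod>p\<in>U. ?g T p)"
      by (rule prod.cong[OF refl]) (use U f(2) in \<open>auto simp: \<Phi>_def\<close>)
    finally show "(\<Prod>p\<in>\<Phi> ` U. ?g T' p) = (\<Prod>p\<in>U. ?g T p)" .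
  qed
  finally show ?thesis by (simp add: krawtchouk_def)
qed

lemma krawtchouk_unit:
  assumes k: "k < t"
  shows "krawtchouk t n (\<lambda>i. if i = k then 1 else 0) c = (\<Sum>j<n k. c k j)"
proof -
  have "supports t n (\<lambda>i. if i = k then 1 else 0) = (\<lambda>j. {(k, j)}) ` {..<n k}" (is "?L = ?R")
  proof (intro equalityI subsetI)
    fix U assume "U \<in> ?L"
    then have U: "U \<subseteq> idx t n" "\<And>i. i < t \<Longrightarrow> card {j. (i, j) \<in> U} = (if i = k then 1 else 0)"
      by (auto simp: supports_def)
    \<comment> \<open>Cardinality 0 means empty only for finite sets, and the rows other than
      \<open>k\<close> must be shown empty below.\<close>
    have fin: "finite {j. (i, j) \<in> U}" for i
      by (rule finite_subset[of _ "{..<n i}"]) (use U(1) in auto)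
    from U(2)[OF k] obtain j where j: "{j. (k, j) \<in> U} = {j}" by (auto simp: card_1_singleton_iff)
    have "i = k \<and> l = j" if "(i, l) \<in> U" for i l
    proof (cases "i = k")
      case True then show ?thesis using that j by auto
    next
      case False
      moreover have "i < t" using U(1) that by auto
      ultimately have "{j. (i, j) \<in> U} = {}" using U(2)[of i] fin[of i] by simp
      then show ?thesis using that by auto
    qed
    then have "U = {(k, j)}" using j by auto
    then show "U \<in> ?R" using U(1) by auto
  next
    fix U assume "U \<in> ?R"
    then obtain j where j: "j < n k" "U = {(k, j)}" by auto
    then have "{l. (i, l) \<in> U} = (if i = k then {j} else {})" for i by auto
    then show "U \<in> ?L" using j k by (auto simp: supports_def)
  qed
  moreover have "inj_on (\<lambda>j. {(k, j)}) {..<n k}" by (auto intro: inj_onI)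
  ultimately show ?thesis unfolding krawtchouk_def by (simp add: sum.reindex)
qed

text \<open>Each of the \<open>n k\<close> positions contributes \<open>q k - 1\<close>, and each
  position in \<open>T\<close> lowers this by \<open>q k\<close>. For nonzero \<open>q k\<close> the
  value therefore determines the count.\<close>

lemma krawtchouk_unit_eq:
  fixes q :: "nat \<Rightarrow> complex"
  assumes k: "k < t"
  shows "krawtchouk t n (\<lambda>i. if i = k then 1 else 0) (\<lambda>i j. if T i j then -1 else q i - 1)
    = of_nat (n k) * (q k - 1) - q k * of_nat (card {j. j < n k \<and> T k j})"
proof -
  have "(\<Sum>j<n k. if T k j then -1 else q k - 1) = (\<Sum>j<n k. (q k - 1) - q k * (if T k j then 1 else 0))"
    by (rule sum.cong) auto
  also have "\<dots> = of_nat (n k) * (q k - 1) - q k * (\<Sum>j<n k. if T k j then 1 else 0)"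
    by (simp add: sum_subtractf sum_distrib_left)
  also have "(\<Sum>j<n k. if T k j then 1 else 0 :: complex) = of_nat (card {j. j < n k \<and> T k j})"
    by (simp add: sum.If_cases lessThan_def Collect_conj_eq)
  finally show ?thesis by (simp only: krawtchouk_unit[OF k])
qed

section \<open>Products of local rings\<close>

text \<open>Induction on the size of the left ideal generated by \<open>x\<close>. The difference of
  two weights sums to zero over this ideal, vanishes by induction at elements generating a smaller
  ideal, and is constant on the generators \<open>G\<close>. Since \<open>x\<close> itself is a
  generator, that constant is 0.\<close>

lemma (in ring) hom_weight_unique:
  assumes fin: "finite (carrier R)" and w: "is_hom_weight R w" and w': "is_hom_weight R w'"
  shows "w = w'"
proof
  let ?P = "\<lambda>x. (\<lambda>r. r \<otimes> x) ` carrier R"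
  have eq: "w x = w' x" if "x \<in> carrier R" for x
    using that
  proof (induction "card (?P x)" arbitrary: x rule: less_induct)
    case less
    note x = less.prems
    show ?case
    proof (cases "x = \<zero>")
      case True then show ?thesis using w w' by (simp add: is_hom_weight_def)
    next
      case False
      have finP: "finite (?P x)" using fin by simp
      have sum: "(\<Sum>y\<in>?P x. w y - w' y) = 0"
        using w w' x False by (simp add: is_hom_weight_def sum_subtractf)
      have val: "w y - w' y = (if ?P y = ?P x then w x - w' x else 0)" if y: "y \<in> ?P x" for y
      proof (cases "?P y = ?P x")
        case True
        have "y \<in> carrier R" using y x by auto
        then have "w y = w x" "w' y = w' x" using True w w' x unfolding is_hom_weight_def by blast+
        then show ?thesis using True by simp
      next
        case False
        have "?P y \<subseteq> ?P x" by (rule left_ideal_principal_subset[OF left_ideal_principal[OF x] y])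
        then have "card (?P y) < card (?P x)" using False finP by (intro psubset_card_mono) auto
        then have "w y = w' y" using less.hyps[of y] y x by auto
        then show ?thesis using False by simp
      qed
      define G where "G = {y \<in> ?P x. ?P y = ?P x}"
      have "(\<Sum>y\<in>?P x. w y - w' y) = (\<Sum>y\<in>?P x. if ?P y = ?P x then w x - w' x else 0)"
        by (rule sum.cong[OF refl val])
      also have "\<dots> = (\<Sum>y\<in>G. w x - w' x)"
        unfolding G_def by (rule sum.inter_filter[OF finP, symmetric])
      also have "\<dots> = of_nat (card G) * (w x - w' x)" by simp
      finally have "of_nat (card G) * (w x - w' x) = 0" using sum by simp
      moreover have "x \<in> G" using mem_principal[OF x] by (simp add: G_def)
      moreover have "finite G" using finP by (simp add: G_def)
      ultimately show ?thesis by (auto simp: card_eq_0_iff)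
    qed
  qed
  fix x show "w x = w' x"
  proof (cases "x \<in> carrier R")
    case False
    have "w \<in> extensional (carrier R)" "w' \<in> extensional (carrier R)"
      using w w' unfolding is_hom_weight_def by blast+
    then show ?thesis using extensional_arb[OF _ False, of w] extensional_arb[OF _ False, of w'] by simp
  qed (rule eq)
qed

section \<open>The product ring and its components\<close>

locale socle_product =
  fixes t :: nat and n q :: "nat \<Rightarrow> nat" and S :: "nat \<Rightarrow> nat \<Rightarrow> ('c, 'm) ring_scheme"
  assumes component: "\<And>i j. in_idx t n i j \<Longrightarrow> simple_socle_ring (S i j)"
    and card_lsoc: "\<And>i j. in_idx t n i j \<Longrightarrow> card (lsoc (S i j)) = q i"
begin

abbreviation P where "P \<equiv> prod_ring t n S"

lemma component_local: "in_idx t n i j \<Longrightarrow> finite_local_ring (S i j)"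
  using component by (simp add: simple_socle_ring_def)

lemma component_ring: "in_idx t n i j \<Longrightarrow> ring (S i j)"
  using component_local by (simp add: finite_local_ring_def)

lemmas component_simps = ring.ring_simprules[OF component_ring] monoid.r_one[OF ring.is_monoid[OF component_ring]]

lemma carrier_P: "carrier P = box t n (\<lambda>i j. carrier (S i j))"
  by (simp add: prod_ring_def box_def)

lemma carrier_P_component: "a \<in> carrier P \<Longrightarrow> in_idx t n i j \<Longrightarrow> a i j \<in> carrier (S i j)"
  by (simp add: prod_ring_def)

lemma P_simps:
  "(a \<otimes>\<^bsub>P\<^esub> b) i j = (if in_idx t n i j then a i j \<otimes>\<^bsub>S i j\<^esub> b i j else undefined)"
  "(a \<oplus>\<^bsub>P\<^esub> b) i j = (if in_idx t n i j then a i j \<oplus>\<^bsub>S i j\<^esub> b i j else undefined)"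
  "\<one>\<^bsub>P\<^esub> i j = (if in_idx t n i j then \<one>\<^bsub>S i j\<^esub> else undefined)"
  "\<zero>\<^bsub>P\<^esub> i j = (if in_idx t n i j then \<zero>\<^bsub>S i j\<^esub> else undefined)"
  by (simp_all add: prod_ring_def)

lemma P_eqI:
  assumes "a \<in> carrier P" "b \<in> carrier P" "\<And>i j. in_idx t n i j \<Longrightarrow> a i j = b i j"
  shows "a = b"
proof (intro ext)
  fix i j show "a i j = b i j"
    using assms by (cases "in_idx t n i j") (auto simp: prod_ring_def)
qed

lemma P_closed:
  "\<lbrakk>a \<in> carrier P; b \<in> carrier P\<rbrakk> \<Longrightarrow> a \<otimes>\<^bsub>P\<^esub> b \<in> carrier P"
  "\<lbrakk>a \<in> carrier P; b \<in> carrier P\<rbrakk> \<Longrightarrow> a \<oplus>\<^bsub>P\<^esub> b \<in> carrier P"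
  "\<one>\<^bsub>P\<^esub> \<in> carrier P" "\<zero>\<^bsub>P\<^esub> \<in> carrier P"
  "a \<in> carrier P \<Longrightarrow> (\<lambda>i j. if in_idx t n i j then \<ominus>\<^bsub>S i j\<^esub> a i j else undefined) \<in> carrier P"
  by (simp_all add: prod_ring_def component_simps)

lemma P_neg_add:
  "a \<in> carrier P \<Longrightarrow> (\<lambda>i j. if in_idx t n i j then \<ominus>\<^bsub>S i j\<^esub> a i j else undefined) \<oplus>\<^bsub>P\<^esub> a = \<zero>\<^bsub>P\<^esub>"
  by (rule P_eqI) (simp_all add: P_closed P_simps carrier_P_component component_simps)

sublocale P: ring P
proof (rule ringI)
  show "abelian_group P"
  proof (rule abelian_groupI)
    fix x assume "x \<in> carrier P"
    then show "\<exists>y\<in>carrier P. y \<oplus>\<^bsub>P\<^esub> x = \<zero>\<^bsub>P\<^esub>" using P_neg_add P_closed(5) by blast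
  qed (auto intro!: P_eqI simp: P_closed P_simps carrier_P_component component_simps)
  show "monoid P"
    by (rule monoidI) (auto intro!: P_eqI simp: P_closed P_simps carrier_P_component component_simps)
qed (auto intro!: P_eqI simp: P_closed P_simps carrier_P_component component_simps)

lemma P_minus:
  assumes "a \<in> carrier P" "in_idx t n i j"
  shows "(\<ominus>\<^bsub>P\<^esub> a) i j = \<ominus>\<^bsub>S i j\<^esub> a i j"
  using P.minus_equality[OF P_neg_add[OF assms(1)] assms(1) P_closed(5)[OF assms(1)]] assms(2)
  by (metis (full_types))

lemma finite_P: "finite (carrier P)"
  unfolding carrier_P
  by (rule finite_box) (simp add: finite_local_ring.finite_carrier component_local in_idx_def)

definition emb :: "nat \<Rightarrow> nat \<Rightarrow> 'c \<Rightarrow> nat \<Rightarrow> nat \<Rightarrow> 'c" where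
  "emb i j x = (\<lambda>i' j'. if in_idx t n i' j' then (if i' = i \<and> j' = j then x else \<zero>\<^bsub>S i' j'\<^esub>) else undefined)"

lemma emb_apply: "in_idx t n i j \<Longrightarrow> emb i j x i j = x"
  by (simp add: emb_def)

lemma emb_closed: "x \<in> carrier (S i j) \<Longrightarrow> emb i j x \<in> carrier P"
  by (auto simp: prod_ring_def emb_def component_simps)

lemma emb_mult_left:
  assumes "in_idx t n i j" "s \<in> carrier (S i j)" "a \<in> carrier P"
  shows "emb i j s \<otimes>\<^bsub>P\<^esub> a = emb i j (s \<otimes>\<^bsub>S i j\<^esub> a i j)"
proof (rule P_eqI)
  show "emb i j s \<otimes>\<^bsub>P\<^esub> a \<in> carrier P" using assms by (simp add: emb_closed)
  show "emb i j (s \<otimes>\<^bsub>S i j\<^esub> a i j) \<in> carrier P"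
    using assms by (simp add: emb_closed carrier_P_component component_simps)
qed (use assms in \<open>auto simp: P_simps emb_def carrier_P_component component_simps\<close>)

lemma emb_add:
  assumes "in_idx t n i j" "x \<in> carrier (S i j)" "y \<in> carrier (S i j)"
  shows "emb i j (x \<oplus>\<^bsub>S i j\<^esub> y) = emb i j x \<oplus>\<^bsub>P\<^esub> emb i j y"
proof (rule P_eqI)
  show "emb i j (x \<oplus>\<^bsub>S i j\<^esub> y) \<in> carrier P" using assms by (simp add: emb_closed component_simps)
  show "emb i j x \<oplus>\<^bsub>P\<^esub> emb i j y \<in> carrier P" using assms by (simp add: emb_closed)
qed (use assms in \<open>auto simp: P_simps emb_def component_simps\<close>)

lemma emb_zero: "in_idx t n i j \<Longrightarrow> emb i j \<zero>\<^bsub>S i j\<^esub> = \<zero>\<^bsub>P\<^esub>"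
  by (auto simp: emb_def P_simps fun_eq_iff)

text \<open>Multiplying by an element supported at one position cuts out that component, so a left
  ideal of the product can be examined position by position.\<close>

lemma left_ideal_emb:
  assumes "left_ideal P I" "x \<in> I" "in_idx t n i j" "s \<in> carrier (S i j)"
  shows "emb i j (s \<otimes>\<^bsub>S i j\<^esub> x i j) \<in> I"
  using left_ideal_closed(4)[OF assms(1) emb_closed[OF assms(4)] assms(2)]
    emb_mult_left[OF assms(3,4) left_ideal_closed(1)[OF assms(1,2)]] by simp

text \<open>Builds \<open>a\<close> by adding one component at a time. It serves both membership in
  left ideals and the factorization of a character; the latter uses that \<open>b\<close> vanishes
  at the position being filled.\<close>

lemma P_component_induct:
  assumes a: "a \<in> carrier P" and zero: "Q \<zero>\<^bsub>P\<^esub>"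
    and step: "\<And>i j b. in_idx t n i j \<Longrightarrow> b \<in> carrier P \<Longrightarrow> b i j = \<zero>\<^bsub>S i j\<^esub> \<Longrightarrow>
      Q b \<Longrightarrow> Q (emb i j (a i j) \<oplus>\<^bsub>P\<^esub> b)"
  shows "Q a"
proof -
  \<comment> \<open>\<open>res F\<close> keeps the components of \<open>a\<close> in
    \<open>F\<close> and is zero elsewhere; the induction runs over \<open>F\<close>.\<close>
  define res where "res F = (\<lambda>i j. if in_idx t n i j then if (i, j) \<in> F then a i j else \<zero>\<^bsub>S i j\<^esub> else undefined)" for F
  have res_closed: "res F \<in> carrier P" for F
    using a by (auto simp: prod_ring_def res_def component_simps)
  have "Q (res F)" if "finite F" "F \<subseteq> idx t n" for F
    using that
  proof (induction F)
    case empty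
    have "res {} = \<zero>\<^bsub>P\<^esub>" by (auto simp: res_def P_simps fun_eq_iff)
    then show ?case using zero by simp
  next
    case (insert p F)
    obtain i j where p: "p = (i, j)" by (cases p)
    have ij: "in_idx t n i j" using insert.prems p by (auto simp: in_idx_def)
    have "res (insert p F) = emb i j (a i j) \<oplus>\<^bsub>P\<^esub> res F"
      by (rule P_eqI[OF res_closed P.a_closed[OF emb_closed res_closed]])
        (use a ij insert.hyps p in \<open>auto simp: res_def emb_def P_simps carrier_P_component component_simps\<close>)
    moreover have "Q (emb i j (a i j) \<oplus>\<^bsub>P\<^esub> res F)"
    proof (rule step[OF ij res_closed])
      show "res F i j = \<zero>\<^bsub>S i j\<^esub>" using ij insert.hyps p by (simp add: res_def)
      show "Q (res F)" using insert by simp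
    qed
    ultimately show ?case by simp
  qed
  then have "Q (res (idx t n))" by simp
  moreover have "res (idx t n) = a"
    by (rule P_eqI[OF res_closed a]) (auto simp: res_def in_idx_def)
  ultimately show ?thesis by simp
qed

lemma left_ideal_memI:
  assumes I: "left_ideal P I" and a: "a \<in> carrier P"
    and comps: "\<And>i j. in_idx t n i j \<Longrightarrow> emb i j (a i j) \<in> I"
  shows "a \<in> I"
proof (rule P_component_induct[of a "\<lambda>a. a \<in> I"])
  show "emb i j (a i j) \<oplus>\<^bsub>P\<^esub> b \<in> I" if "in_idx t n i j" "b \<in> I" for i j b
    by (rule left_ideal_closed(3)[OF I comps[OF that(1)] that(2)])
qed (rule a left_ideal_closed(2)[OF I])+

lemma box_subset_carrier:
  assumes "\<And>i j. in_idx t n i j \<Longrightarrow> B i j \<subseteq> carrier (S i j)"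
  shows "box t n B \<subseteq> carrier P"
  using assms unfolding carrier_P box_def by blast

lemma left_ideal_box:
  assumes B: "\<And>i j. in_idx t n i j \<Longrightarrow> left_ideal (S i j) (B i j)"
  shows "left_ideal P (box t n B)"
proof -
  have sub: "box t n B \<subseteq> carrier P"
    by (rule box_subset_carrier) (use B in \<open>auto simp: left_ideal_def\<close>)
  have memI: "a \<in> box t n B" if "a \<in> carrier P" "\<And>i j. in_idx t n i j \<Longrightarrow> a i j \<in> B i j" for a
    using that by (simp add: box_def prod_ring_def)
  have memD: "a i j \<in> B i j" if "a \<in> box t n B" "in_idx t n i j" for a i j
    using that by (simp add: box_def)
  have neg: "\<ominus>\<^bsub>S i j\<^esub> x \<in> B i j" if "in_idx t n i j" "x \<in> B i j" for i j x
    using B[OF that(1)] that(2) by (simp add: left_ideal_def)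
  show ?thesis unfolding left_ideal_def
  proof (intro conjI ballI sub)
    show "\<zero>\<^bsub>P\<^esub> \<in> box t n B"
      by (rule memI) (simp_all add: P_simps left_ideal_closed(2)[OF B])
    fix x assume x: "x \<in> box t n B"
    then have xc: "x \<in> carrier P" using sub by blast
    show "\<ominus>\<^bsub>P\<^esub> x \<in> box t n B"
      by (rule memI) (use x xc in \<open>simp_all add: P_minus memD neg\<close>)
    show "x \<oplus>\<^bsub>P\<^esub> y \<in> box t n B" if "y \<in> box t n B" for y
      by (rule memI) (use x that sub in \<open>auto simp: P_simps memD left_ideal_closed(3)[OF B]\<close>)
    show "r \<otimes>\<^bsub>P\<^esub> x \<in> box t n B" if "r \<in> carrier P" for r
      by (rule memI) (use x xc that in \<open>auto simp: P_simps memD left_ideal_closed(4)[OF B] carrier_P_component\<close>)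
  qed
qed

section \<open>Socle and radical of the product\<close>

lemma emb_image_minimal:
  assumes ij: "in_idx t n i j" and I: "left_ideal P I" "I \<noteq> {\<zero>\<^bsub>P\<^esub>}" "I \<subseteq> emb i j ` lsoc (S i j)"
  shows "emb i j ` lsoc (S i j) \<subseteq> I"
proof -
  interpret C: simple_socle_ring "S i j" by (rule component[OF ij])
  obtain x where x: "x \<in> I" "x \<noteq> \<zero>\<^bsub>P\<^esub>" using I(2) left_ideal_closed(2)[OF I(1)] by fast
  then obtain c where c: "c \<in> lsoc (S i j)" "x = emb i j c" using I(3) by blast
  then have "c \<noteq> \<zero>\<^bsub>S i j\<^esub>" using x emb_zero[OF ij] by auto
  then have soc: "(\<lambda>r. r \<otimes>\<^bsub>S i j\<^esub> c) ` carrier (S i j) = lsoc (S i j)" by (rule C.lsoc_eq_principal[OF c(1)])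
  show ?thesis
  proof
    fix y assume "y \<in> emb i j ` lsoc (S i j)"
    then obtain s where "s \<in> carrier (S i j)" "y = emb i j (s \<otimes>\<^bsub>S i j\<^esub> c)"
      unfolding soc[symmetric] by auto
    then show "y \<in> I" using left_ideal_emb[OF I(1) x(1) ij] c emb_apply[OF ij] by simp
  qed
qed

lemma emb_lsoc_left_ideal:
  assumes ij: "in_idx t n i j"
  shows "left_ideal P (emb i j ` lsoc (S i j))"
proof -
  interpret C: simple_socle_ring "S i j" by (rule component[OF ij])
  \<comment> \<open>The embedded socle is a box with the zero ideal at every other position, so
    \<open>left_ideal_box\<close> applies.\<close>
  let ?B = "\<lambda>i' j'. if i' = i \<and> j' = j then lsoc (S i j) else {\<zero>\<^bsub>S i' j'\<^esub>}"
  have "emb i j ` lsoc (S i j) = box t n ?B"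
  proof (intro equalityI subsetI)
    fix a assume "a \<in> box t n ?B"
    then have a: "in_idx t n i' j' \<longrightarrow> a i' j' \<in> ?B i' j'" "\<not> in_idx t n i' j' \<longrightarrow> a i' j' = undefined" for i' j'
      unfolding box_def by blast+
    have "a i j \<in> lsoc (S i j)" using a(1)[of i j] ij by simp
    moreover have "a i' j' = emb i j (a i j) i' j'" for i' j'
      using a[of i' j'] by (auto simp: emb_def split: if_splits)
    then have "a = emb i j (a i j)" by blast
    ultimately show "a \<in> emb i j ` lsoc (S i j)" by blast
  qed (auto simp: box_def emb_def)
  moreover have "left_ideal P (box t n ?B)"
  proof (rule left_ideal_box)
    fix i' j' assume "in_idx t n i' j'"
    then interpret C': ring "S i' j'" by (rule component_ring)
    show "left_ideal (S i' j') (?B i' j')"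
      using C.lsoc_left_ideal by (auto simp: left_ideal_def[of _ "{_}"])
  qed
  ultimately show ?thesis by simp
qed

text \<open>The minimal left ideals of the product are the embedded component socles. A nonzero
  component of an element of \<open>I\<close> generates a left ideal containing the component socle,
  so \<open>I\<close> contains its embedding and equals it by minimality.\<close>

lemma lsoc_P: "lsoc P = box t n (\<lambda>i j. lsoc (S i j))"
proof
  have lb: "left_ideal P (box t n (\<lambda>i j. lsoc (S i j)))"
    by (rule left_ideal_box) (rule finite_local_ring.lsoc_left_ideal[OF component_local])
  have "I \<subseteq> box t n (\<lambda>i j. lsoc (S i j))" if I: "minimal_left_ideal P I" for I
  proof -
    have li: "left_ideal P I" "I \<noteq> {\<zero>\<^bsub>P\<^esub>}" using I by (auto simp: minimal_left_ideal_def)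
    then obtain x where x: "x \<in> I" "x \<noteq> \<zero>\<^bsub>P\<^esub>" using left_ideal_closed(2)[OF li(1)] by fast
    have xc: "x \<in> carrier P" by (rule left_ideal_closed(1)[OF li(1) x(1)])
    obtain i j where ij: "in_idx t n i j" "x i j \<noteq> \<zero>\<^bsub>S i j\<^esub>"
      using P_eqI[OF xc P.zero_closed] x(2) by (auto simp: P_simps)
    interpret C: simple_socle_ring "S i j" by (rule component[OF ij(1)])
    have xij: "x i j \<in> carrier (S i j)" by (rule carrier_P_component[OF xc ij(1)])
    have "lsoc (S i j) \<subseteq> (\<lambda>r. r \<otimes>\<^bsub>S i j\<^esub> x i j) ` carrier (S i j)"
      using C.lsoc_subset_left_ideal[OF C.left_ideal_principal[OF xij]] C.mem_principal[OF xij] ij(2)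
      by blast
    then have sub: "emb i j ` lsoc (S i j) \<subseteq> I" using left_ideal_emb[OF li(1) x(1) ij(1)] by blast
    obtain c where c: "c \<in> lsoc (S i j)" "c \<noteq> \<zero>\<^bsub>S i j\<^esub>" by (rule C.lsoc_nonzero)
    have "emb i j c \<noteq> \<zero>\<^bsub>P\<^esub>" using c(2) ij(1) by (auto simp: emb_def P_simps fun_eq_iff)
    then have "emb i j ` lsoc (S i j) \<noteq> {\<zero>\<^bsub>P\<^esub>}" using c(1) by blast
    then have "emb i j ` lsoc (S i j) = I"
      using I sub emb_lsoc_left_ideal[OF ij(1)] unfolding minimal_left_ideal_def by blast
    moreover have "emb i j ` lsoc (S i j) \<subseteq> box t n (\<lambda>i j. lsoc (S i j))"
      using left_ideal_closed(2)[OF finite_local_ring.lsoc_left_ideal[OF component_local]]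
      by (auto simp: box_def emb_def)
    ultimately show ?thesis by simp
  qed
  then show "lsoc P \<subseteq> box t n (\<lambda>i j. lsoc (S i j))" using lb unfolding lsoc_def[of P] by blast
next
  show "box t n (\<lambda>i j. lsoc (S i j)) \<subseteq> lsoc P"
  proof
    fix a assume a: "a \<in> box t n (\<lambda>i j. lsoc (S i j))"
    have ac: "a \<in> carrier P"
      using a box_subset_carrier[of "\<lambda>i j. lsoc (S i j)"] simple_socle_ring.lsoc_closed[OF component] by blast
    have "a \<in> J" if J: "left_ideal P J" "\<forall>I. minimal_left_ideal P I \<longrightarrow> I \<subseteq> J" for J
    proof (rule left_ideal_memI[OF J(1) ac])
      fix i j assume ij: "in_idx t n i j"
      interpret C: simple_socle_ring "S i j" by (rule component[OF ij])
      obtain c where c: "c \<in> lsoc (S i j)" "c \<noteq> \<zero>\<^bsub>S i j\<^esub>" by (rule C.lsoc_nonzero)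
      have "emb i j c \<noteq> \<zero>\<^bsub>P\<^esub>" using c(2) ij by (auto simp: emb_def P_simps fun_eq_iff)
      then have "emb i j ` lsoc (S i j) \<noteq> {\<zero>\<^bsub>P\<^esub>}" using c(1) by blast
      then have "minimal_left_ideal P (emb i j ` lsoc (S i j))"
        unfolding minimal_left_ideal_def
        using emb_image_minimal[OF ij] emb_lsoc_left_ideal[OF ij] by blast
      then have "emb i j ` lsoc (S i j) \<subseteq> J" using J(2) by simp
      then show "emb i j (a i j) \<in> J" using a ij by (auto simp: box_def)
    qed
    then show "a \<in> lsoc P" unfolding lsoc_def[of P] by simp
  qed
qed

text \<open>A left ideal properly above \<open>?M\<close> has an element with invertible component
  at \<open>(i, j)\<close>. This supplies the embedded unit there, those at the other positions
  already lie in \<open>?M\<close>, and together they sum to 1.\<close>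

lemma component_maximal:
  assumes ij: "in_idx t n i j"
  shows "maximal_left_ideal P {a \<in> carrier P. a i j \<in> jrad (S i j)}" (is "maximal_left_ideal P ?M")
proof -
  interpret C: simple_socle_ring "S i j" by (rule component[OF ij])
  have "?M = box t n (\<lambda>i' j'. if i' = i \<and> j' = j then jrad (S i j) else carrier (S i' j'))"
    using ij C.jrad_closed by (auto simp: box_def prod_ring_def)
  moreover have "left_ideal P \<dots>"
  proof (rule left_ideal_box)
    fix i' j' assume "in_idx t n i' j'"
    then interpret C': ring "S i' j'" by (rule component_ring)
    show "left_ideal (S i' j') (if i' = i \<and> j' = j then jrad (S i j) else carrier (S i' j'))"
      using C.jrad_left_ideal C'.left_ideal_carrier by simp
  qed
  ultimately have li: "left_ideal P ?M" by simp
  have "\<one>\<^bsub>P\<^esub> \<notin> ?M" using C.one_notin_jrad ij by (simp add: P_simps)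
  then have ne: "?M \<noteq> carrier P" using P.one_closed by blast
  have "J = ?M" if J: "left_ideal P J" "?M \<subseteq> J" "J \<noteq> carrier P" for J
  proof (rule ccontr)
    assume "J \<noteq> ?M"
    then obtain a where a: "a \<in> J" "a \<notin> ?M" using J(2) by blast
    have ac: "a \<in> carrier P" by (rule left_ideal_closed(1)[OF J(1) a(1)])
    then have aij: "a i j \<in> carrier (S i j)" "a i j \<notin> jrad (S i j)"
      using a carrier_P_component ij by auto
    then obtain u where u: "u \<in> carrier (S i j)" "u \<otimes>\<^bsub>S i j\<^esub> a i j = \<one>\<^bsub>S i j\<^esub>"
      using C.inverse_if_notin_jrad by blast
    have "\<one>\<^bsub>P\<^esub> \<in> J"
    proof (rule left_ideal_memI[OF J(1) P.one_closed])
      fix i' j' assume ij': "in_idx t n i' j'"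
      show "emb i' j' (\<one>\<^bsub>P\<^esub> i' j') \<in> J"
      proof (cases "i' = i \<and> j' = j")
        case True
        then show ?thesis using left_ideal_emb[OF J(1) a(1) ij u(1)] u(2) ij by (simp add: P_simps)
      next
        case False
        have "emb i' j' (\<one>\<^bsub>P\<^esub> i' j') \<in> carrier P"
          by (rule emb_closed[OF carrier_P_component[OF P.one_closed ij']])
        then have "emb i' j' (\<one>\<^bsub>P\<^esub> i' j') \<in> ?M"
          using False ij left_ideal_closed(2)[OF C.jrad_left_ideal] by (auto simp: emb_def)
        then show ?thesis using J(2) by blast
      qed
    qed
    then show False using P.left_ideal_one[OF J(1)] J(3) by simp
  qed
  then show ?thesis unfolding maximal_left_ideal_def using li ne by blast
qed

text \<open>Every maximal left ideal of the product is of the form in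
  \<open>component_maximal\<close>: if at each position some element of \<open>J\<close> had a
  nonradical component, then \<open>J\<close> would contain all embedded units and hence 1.\<close>

lemma jrad_P: "jrad P = box t n (\<lambda>i j. jrad (S i j))"
proof
  show "jrad P \<subseteq> box t n (\<lambda>i j. jrad (S i j))"
  proof
    fix a assume "a \<in> jrad P"
    then have "a \<in> carrier P" "\<And>i j. in_idx t n i j \<Longrightarrow> a i j \<in> jrad (S i j)"
      using component_maximal unfolding jrad_def[of P] by auto
    then show "a \<in> box t n (\<lambda>i j. jrad (S i j))" by (simp add: box_def prod_ring_def)
  qed
next
  show "box t n (\<lambda>i j. jrad (S i j)) \<subseteq> jrad P"
  proof
    fix a assume a: "a \<in> box t n (\<lambda>i j. jrad (S i j))"
    have ac: "a \<in> carrier P"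
      using a box_subset_carrier[of "\<lambda>i j. jrad (S i j)"] finite_local_ring.jrad_closed[OF component_local] by blast
    have "a \<in> J" if J: "maximal_left_ideal P J" for J
    proof -
      have li: "left_ideal P J" "J \<noteq> carrier P" using J by (auto simp: maximal_left_ideal_def)
      have "\<exists>i j. in_idx t n i j \<and> (\<forall>x\<in>J. x i j \<in> jrad (S i j))"
      proof (rule ccontr)
        assume none: "\<not> ?thesis"
        have "\<one>\<^bsub>P\<^esub> \<in> J"
        proof (rule left_ideal_memI[OF li(1) P.one_closed])
          fix i j assume ij: "in_idx t n i j"
          interpret C: simple_socle_ring "S i j" by (rule component[OF ij])
          obtain x where x: "x \<in> J" "x i j \<notin> jrad (S i j)" using none ij by blast
          have "x i j \<in> carrier (S i j)"
            by (rule carrier_P_component[OF left_ideal_closed(1)[OF li(1) x(1)] ij])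
          then obtain u where u: "u \<in> carrier (S i j)" "u \<otimes>\<^bsub>S i j\<^esub> x i j = \<one>\<^bsub>S i j\<^esub>"
            using C.inverse_if_notin_jrad x(2) by blast
          show "emb i j (\<one>\<^bsub>P\<^esub> i j) \<in> J"
            using left_ideal_emb[OF li(1) x(1) ij u(1)] u(2) ij by (simp add: P_simps)
        qed
        then show False using P.left_ideal_one[OF li(1)] li(2) by simp
      qed
      then obtain i j where ij: "in_idx t n i j" "\<And>x. x \<in> J \<Longrightarrow> x i j \<in> jrad (S i j)" by blast
      let ?M = "{a \<in> carrier P. a i j \<in> jrad (S i j)}"
      have "J \<subseteq> ?M" using ij(2) left_ideal_closed(1)[OF li(1)] by blast
      then have "?M = J"
        using J component_maximal[OF ij(1)] unfolding maximal_left_ideal_def by blast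
      moreover have "a \<in> ?M" using a ac ij(1) by (simp add: box_def)
      ultimately show ?thesis by simp
    qed
    then show "a \<in> jrad P" unfolding jrad_def[of P] using ac by simp
  qed
qed

section \<open>The homogeneous weight\<close>

lemma idx_in_idx: "p \<in> idx t n \<Longrightarrow> in_idx t n (fst p) (snd p)"
  by (auto simp: in_idx_def)

lemma finite_component: "in_idx t n i j \<Longrightarrow> finite (carrier (S i j))"
  by (rule finite_local_ring.finite_carrier[OF component_local])

lemma q_ge_2: "in_idx t n i j \<Longrightarrow> q i \<ge> 2"
  using simple_socle_ring.card_lsoc_ge_2[OF component] card_lsoc by metis

lemma finite_lsoc: "in_idx t n i j \<Longrightarrow> finite (lsoc (S i j))"
  using q_ge_2 card_lsoc by (metis card.infinite not_numeral_le_zero)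

lemma zero_in_lsoc: "in_idx t n i j \<Longrightarrow> \<zero>\<^bsub>S i j\<^esub> \<in> lsoc (S i j)"
  by (rule left_ideal_closed(2)[OF finite_local_ring.lsoc_left_ideal[OF component_local]])

lemma mem_lsoc_P: "a \<in> carrier P \<Longrightarrow> a \<in> lsoc P \<longleftrightarrow> (\<forall>p\<in>idx t n. a (fst p) (snd p) \<in> lsoc (S (fst p) (snd p)))"
  unfolding lsoc_P carrier_P mem_box by auto

lemma lsoc_P_closed: "a \<in> lsoc P \<Longrightarrow> a \<in> carrier P"
  using box_subset_carrier[of "\<lambda>i j. lsoc (S i j)"] simple_socle_ring.lsoc_closed[OF component]
  unfolding lsoc_P by blast

lemma mem_jrad_P: "a \<in> carrier P \<Longrightarrow> a \<in> jrad P \<longleftrightarrow> (\<forall>p\<in>idx t n. a (fst p) (snd p) \<in> jrad (S (fst p) (snd p)))"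
  unfolding jrad_P carrier_P mem_box by auto

definition hom_factor :: "nat \<Rightarrow> nat \<Rightarrow> 'c \<Rightarrow> rat" where
  "hom_factor i j x = (if x = \<zero>\<^bsub>S i j\<^esub> then 1 else if x \<in> lsoc (S i j) then - 1 / (of_nat (q i) - 1) else 0)"

lemma sum_hom_factor:
  assumes ij: "in_idx t n i j" and I: "left_ideal (S i j) I" "I \<noteq> {\<zero>\<^bsub>S i j\<^esub>}"
  shows "(\<Sum>x\<in>I. hom_factor i j x) = 0"
proof -
  interpret C: simple_socle_ring "S i j" by (rule component[OF ij])
  have sub: "lsoc (S i j) \<subseteq> I" by (rule C.lsoc_subset_left_ideal[OF I])
  have "finite I" by (rule finite_subset[OF _ C.finite_carrier]) (use I(1) in \<open>simp add: left_ideal_def\<close>)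
  then have "(\<Sum>x\<in>I. hom_factor i j x) = (\<Sum>x\<in>lsoc (S i j). hom_factor i j x)"
    by (rule sum.mono_neutral_right[OF _ sub]) (use zero_in_lsoc[OF ij] in \<open>auto simp: hom_factor_def\<close>)
  also have "\<dots> = hom_factor i j \<zero>\<^bsub>S i j\<^esub> + (\<Sum>x\<in>lsoc (S i j) - {\<zero>\<^bsub>S i j\<^esub>}. hom_factor i j x)"
    by (rule sum.remove[OF finite_lsoc[OF ij] zero_in_lsoc[OF ij]])
  also have "(\<Sum>x\<in>lsoc (S i j) - {\<zero>\<^bsub>S i j\<^esub>}. hom_factor i j x) = of_nat (q i - 1) * (- 1 / (of_nat (q i) - 1))"
    using zero_in_lsoc[OF ij] by (simp add: hom_factor_def card_Diff_subset card_lsoc[OF ij])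
  also have "hom_factor i j \<zero>\<^bsub>S i j\<^esub> + \<dots> = 0"
    using q_ge_2[OF ij] by (simp add: hom_factor_def of_nat_diff)
  finally show ?thesis .
qed

lemma principal_P:
  assumes x: "x \<in> carrier P"
  shows "(\<lambda>r. r \<otimes>\<^bsub>P\<^esub> x) ` carrier P = box t n (\<lambda>i j. (\<lambda>r. r \<otimes>\<^bsub>S i j\<^esub> x i j) ` carrier (S i j))"
    (is "_ = box t n ?B")
proof (intro equalityI subsetI)
  fix a assume "a \<in> (\<lambda>r. r \<otimes>\<^bsub>P\<^esub> x) ` carrier P"
  then show "a \<in> box t n ?B" by (auto simp: box_def P_simps carrier_P_component)
next
  fix a assume a: "a \<in> box t n ?B"
  then have "\<forall>i j. \<exists>r. in_idx t n i j \<longrightarrow> r \<in> carrier (S i j) \<and> a i j = r \<otimes>\<^bsub>S i j\<^esub> x i j"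
    by (auto simp: box_def)
  then obtain r where r: "\<And>i j. in_idx t n i j \<Longrightarrow> r i j \<in> carrier (S i j) \<and> a i j = r i j \<otimes>\<^bsub>S i j\<^esub> x i j"
    by metis
  let ?r = "\<lambda>i j. if in_idx t n i j then r i j else undefined"
  have rc: "?r \<in> carrier P" using r by (simp add: prod_ring_def)
  have "a \<in> carrier P" using a r x unfolding box_def
    by (auto simp: prod_ring_def component_simps)
  then have "a = ?r \<otimes>\<^bsub>P\<^esub> x" by (rule P_eqI[OF _ P.m_closed[OF rc x]]) (simp add: P_simps r)
  then show "a \<in> (\<lambda>r. r \<otimes>\<^bsub>P\<^esub> x) ` carrier P" using rc by blast
qed

definition hom_prod :: "(nat \<Rightarrow> nat \<Rightarrow> 'c) \<Rightarrow> rat" where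
  "hom_prod a = (\<Prod>p\<in>idx t n. hom_factor (fst p) (snd p) (a (fst p) (snd p)))"

text \<open>A factor sees only whether its component is zero and whether it lies in the socle. Both
  properties pass to left multiples, and \<open>x\<close> and \<open>y\<close> are left multiples of
  each other.\<close>

lemma hom_prod_principal_cong:
  assumes xy: "x \<in> carrier P" "y \<in> carrier P"
    and eq: "(\<lambda>r. r \<otimes>\<^bsub>P\<^esub> x) ` carrier P = (\<lambda>r. r \<otimes>\<^bsub>P\<^esub> y) ` carrier P"
  shows "hom_prod x = hom_prod y"
  unfolding hom_prod_def
proof (rule prod.cong[OF refl])
  have *: "(v i j = \<zero>\<^bsub>S i j\<^esub> \<longrightarrow> u i j = \<zero>\<^bsub>S i j\<^esub>) \<and> (v i j \<in> lsoc (S i j) \<longrightarrow> u i j \<in> lsoc (S i j))"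
    if ij: "in_idx t n i j" and uv: "u \<in> (\<lambda>r. r \<otimes>\<^bsub>P\<^esub> v) ` carrier P" for i j u v
  proof -
    interpret C: simple_socle_ring "S i j" by (rule component[OF ij])
    obtain r where r: "r \<in> carrier P" "u = r \<otimes>\<^bsub>P\<^esub> v" using uv by blast
    have "r i j \<in> carrier (S i j)" by (rule carrier_P_component[OF r(1) ij])
    then show ?thesis using r(2) ij left_ideal_closed(4)[OF C.lsoc_left_ideal] by (simp add: P_simps)
  qed
  fix p assume "p \<in> idx t n"
  then have p: "in_idx t n (fst p) (snd p)" by (rule idx_in_idx)
  have "x \<in> (\<lambda>r. r \<otimes>\<^bsub>P\<^esub> y) ` carrier P" "y \<in> (\<lambda>r. r \<otimes>\<^bsub>P\<^esub> x) ` carrier P"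
    using P.mem_principal[OF xy(1)] P.mem_principal[OF xy(2)] eq by simp_all
  from *[OF p this(1)] *[OF p this(2)]
  show "hom_factor (fst p) (snd p) (x (fst p) (snd p)) = hom_factor (fst p) (snd p) (y (fst p) (snd p))"
    unfolding hom_factor_def by argo
qed

text \<open>The sum factors over positions, and a single nonzero component of \<open>x\<close>
  already gives a vanishing factor.\<close>

lemma sum_hom_prod_principal:
  assumes x: "x \<in> carrier P" "x \<noteq> \<zero>\<^bsub>P\<^esub>"
  shows "(\<Sum>y\<in>(\<lambda>r. r \<otimes>\<^bsub>P\<^esub> x) ` carrier P. hom_prod y) = 0"
proof -
  let ?B = "\<lambda>i j. (\<lambda>r. r \<otimes>\<^bsub>S i j\<^esub> x i j) ` carrier (S i j)"
  obtain i j where ij: "in_idx t n i j" "x i j \<noteq> \<zero>\<^bsub>S i j\<^esub>"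
    using P_eqI[OF x(1) P.zero_closed] x(2) by (auto simp: P_simps)
  interpret C: simple_socle_ring "S i j" by (rule component[OF ij(1)])
  have xij: "x i j \<in> carrier (S i j)" by (rule carrier_P_component[OF x(1) ij(1)])
  have "?B i j \<noteq> {\<zero>\<^bsub>S i j\<^esub>}" using C.mem_principal[OF xij] ij(2) by blast
  then have 0: "(\<Sum>b\<in>?B i j. hom_factor i j b) = 0"
    by (rule sum_hom_factor[OF ij(1) C.left_ideal_principal[OF xij]])
  have "(\<Sum>y\<in>box t n ?B. hom_prod y) = (\<Prod>p\<in>idx t n. \<Sum>b\<in>?B (fst p) (snd p). hom_factor (fst p) (snd p) b)"
    unfolding hom_prod_def by (rule sum_box_prod) (simp add: finite_component in_idx_def)
  also have "\<dots> = 0"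
    by (rule prod_zero) (use 0 ij(1) in \<open>auto simp: in_idx_def intro!: bexI[of _ "(i, j)"]\<close>)
  finally show ?thesis unfolding principal_P[OF x(1)] .
qed

lemma hom_weight_P:
  assumes "a \<in> carrier P"
  shows "hom_weight P a = 1 - hom_prod a"
proof -
  \<comment> \<open>\<open>is_hom_weight\<close> fixes the weight also outside the carrier, by
    extensionality.\<close>
  let ?w = "restrict (\<lambda>a. 1 - hom_prod a) (carrier P)"
  have "is_hom_weight P ?w"
    unfolding is_hom_weight_def
  proof (intro conjI ballI impI)
    show "?w \<zero>\<^bsub>P\<^esub> = 0" by (simp add: hom_prod_def hom_factor_def P_simps idx_in_idx)
    fix x assume x: "x \<in> carrier P"
    show "?w x = ?w y" if "y \<in> carrier P"
      "(\<lambda>r. r \<otimes>\<^bsub>P\<^esub> x) ` carrier P = (\<lambda>r. r \<otimes>\<^bsub>P\<^esub> y) ` carrier P" for y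
      using hom_prod_principal_cong[OF x that] x that(1) by simp
    assume nz: "x \<noteq> \<zero>\<^bsub>P\<^esub>"
    let ?I = "(\<lambda>r. r \<otimes>\<^bsub>P\<^esub> x) ` carrier P"
    have "(\<Sum>y\<in>?I. ?w y) = (\<Sum>y\<in>?I. 1 - hom_prod y)"
      by (rule sum.cong) (use x in auto)
    then show "(\<Sum>y\<in>?I. ?w y) = of_nat (card ?I)"
      using sum_hom_prod_principal[OF x nz] by (simp add: sum_subtractf)
  qed simp
  then have "hom_weight P = ?w"
    unfolding hom_weight_def using P.hom_weight_unique[OF finite_P] by (intro the_equality) blast+
  then show ?thesis using assms by simp
qed

lemma hom_prod_lsoc:
  assumes a: "a \<in> lsoc P"
  shows "hom_prod a = (- 1) ^ (\<Sum>i<t. wt n S a i) / of_int (\<Prod>i<t. (int (q i) - 1) ^ wt n S a i)"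
proof -
  have row: "(\<Prod>j<n i. hom_factor i j (a i j)) = (- 1) ^ wt n S a i / (of_nat (q i) - 1) ^ wt n S a i" if i: "i < t" for i
  proof -
    have "(\<Prod>j<n i. hom_factor i j (a i j)) = (\<Prod>j<n i. if a i j \<noteq> \<zero>\<^bsub>S i j\<^esub> then - 1 / (of_nat (q i) - 1) else 1)"
      using a i by (intro prod.cong refl) (auto simp: hom_factor_def lsoc_P mem_box)
    also have "\<dots> = (- 1 / (of_nat (q i) - 1)) ^ wt n S a i"
      by (simp add: prod.If_cases wt_def lessThan_def Collect_conj_eq)
    finally show ?thesis by (simp only: power_divide)
  qed
  have "hom_prod a = (\<Prod>i<t. \<Prod>j<n i. hom_factor i j (a i j))"
    unfolding hom_prod_def by (subst prod.Sigma) (auto simp: case_prod_beta)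
  also have "\<dots> = (\<Prod>i<t. (- 1) ^ wt n S a i / (of_nat (q i) - 1) ^ wt n S a i)"
    by (rule prod.cong) (use row in auto)
  also have "\<dots> = (- 1) ^ (\<Sum>i<t. wt n S a i) / of_int (\<Prod>i<t. (int (q i) - 1) ^ wt n S a i)"
    by (simp add: prod_dividef power_sum)
  finally show ?thesis .
qed

text \<open>The complement of the socle is thus the level set of weight exactly 1, so it can never
  merge with a block inside the socle.\<close>

lemma hom_prod_eq_0_iff:
  assumes "a \<in> carrier P"
  shows "hom_prod a = 0 \<longleftrightarrow> a \<notin> lsoc P"
proof -
  have "hom_factor (fst p) (snd p) x = 0 \<longleftrightarrow> x \<notin> lsoc (S (fst p) (snd p))" if "p \<in> idx t n" for p x
    using q_ge_2[OF idx_in_idx[OF that]] zero_in_lsoc[OF idx_in_idx[OF that]] by (auto simp: hom_factor_def)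
  then show ?thesis unfolding mem_lsoc_P[OF assms] hom_prod_def by auto
qed

lemma wt_le: "wt n S a i \<le> n i"
  unfolding wt_def using card_mono[of "{..<n i}" "{j. j < n i \<and> a i j \<noteq> \<zero>\<^bsub>S i j\<^esub>}"] by auto

text \<open>The equivalence relation behind \<open>H'\<close>. \<open>P_hom\<close> and the duals
  are given by classes, so comparing relations replaces comparing sets of blocks.\<close>

definition same_weight :: "(nat \<Rightarrow> nat \<Rightarrow> 'c) \<Rightarrow> (nat \<Rightarrow> nat \<Rightarrow> 'c) \<Rightarrow> bool" where
  "same_weight a b \<longleftrightarrow> (a \<in> lsoc P \<longleftrightarrow> b \<in> lsoc P) \<and> (a \<in> lsoc P \<longrightarrow> (\<forall>i<t. wt n S a i = wt n S b i))"

text \<open>The bound \<open>q_ge_2\<close> speaks only about nonempty rows; a nonzero weight shows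
  that row \<open>i\<close> is one of these.\<close>

lemma q_pos_factor: "wt n S a i \<noteq> 0 \<Longrightarrow> i < t \<Longrightarrow> int (q i) - 1 > 0"
proof -
  assume "wt n S a i \<noteq> 0" "i < t"
  then have "in_idx t n i 0" using wt_le[of a i] by (auto simp: in_idx_def)
  then show ?thesis using q_ge_2 by fastforce
qed

text \<open>The absolute value of the product factor gives the product in the separating condition, and its sign gives the parity.\<close>

lemma hom_weight_eq_iff:
  assumes sep: "separating t n q" and ab: "a \<in> carrier P" "b \<in> carrier P"
  shows "hom_weight P a = hom_weight P b \<longleftrightarrow> same_weight a b"
proof
  assume "same_weight a b"
  then show "hom_weight P a = hom_weight P b"
    using hom_prod_eq_0_iff[OF ab(1)] hom_prod_eq_0_iff[OF ab(2)] hom_prod_lsoc[of a] hom_prod_lsoc[of b]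
    by (cases "a \<in> lsoc P") (auto simp: hom_weight_P ab same_weight_def)
next
  assume "hom_weight P a = hom_weight P b"
  then have eq: "hom_prod a = hom_prod b" by (simp add: hom_weight_P ab)
  then have soc: "a \<in> lsoc P \<longleftrightarrow> b \<in> lsoc P"
    using hom_prod_eq_0_iff[OF ab(1)] hom_prod_eq_0_iff[OF ab(2)] by simp
  moreover have "\<forall>i<t. wt n S a i = wt n S b i" if a: "a \<in> lsoc P"
  proof -
    define D where "D c = (\<Prod>i<t. (int (q i) - 1) ^ wt n S c i)" for c
    define s where "s c = (\<Sum>i<t. wt n S c i)" for c
    \<comment> \<open>Positivity allows the absolute value to strip off the sign. A row of weight 0
      contributes the empty power 1, whatever the value of \<open>q\<close>.\<close>
    have D: "D c > 0" for c
      unfolding D_def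
    proof (rule prod_pos)
      fix i assume "i \<in> {..<t}"
      then show "(int (q i) - 1) ^ wt n S c i > 0"
        using q_pos_factor[of c i] by (cases "wt n S c i = 0") auto
    qed
    have e: "(- 1) ^ s a / of_int (D a) = ((- 1) ^ s b / of_int (D b) :: rat)"
      using eq unfolding hom_prod_lsoc[OF a] hom_prod_lsoc[OF iffD1[OF soc a]] D_def s_def .
    then have "\<bar>(- 1) ^ s a / of_int (D a) :: rat\<bar> = \<bar>(- 1) ^ s b / of_int (D b)\<bar>" by simp
    then have "of_int (D a) = (of_int (D b) :: rat)" using D[of a] D[of b] by (simp add: abs_divide power_abs)
    then have DD: "D a = D b" by simp
    then have "(- 1) ^ s a = ((- 1) ^ s b :: rat)" using e D[of b] by simp
    then have "s a mod 2 = s b mod 2"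
      by (cases "even (s a)"; cases "even (s b)") (auto simp: even_iff_mod_2_eq_zero odd_iff_mod_2_eq_one)
    moreover have "in_M t n (wt n S c)" for c by (simp add: in_M_def wt_le)
    ultimately show ?thesis using sep DD unfolding separating_def D_def s_def by blast
  qed
  ultimately show "same_weight a b" by (simp add: same_weight_def)
qed

lemma H'_eq_classes: "H' t n S = (\<lambda>a. {b \<in> carrier P. same_weight a b}) ` carrier P"
proof -
  have out: "{b \<in> carrier P. same_weight a b} = carrier P - lsoc P" if "a \<notin> lsoc P" for a
    using that by (auto simp: same_weight_def)
  have inn: "{b \<in> carrier P. same_weight a b} = {b \<in> lsoc P. \<forall>i<t. wt n S b i = wt n S a i}" if "a \<in> lsoc P" for a
    using that lsoc_P_closed by (auto simp: same_weight_def)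
  show ?thesis
  proof (intro equalityI subsetI)
    fix B assume "B \<in> H' t n S"
    then obtain a where a: "a \<in> B" and B: "B = carrier P - lsoc P \<or>
        (\<exists>m. in_M t n m \<and> B = {a \<in> lsoc P. \<forall>i<t. wt n S a i = m i})"
      unfolding H'_def by blast
    have ac: "a \<in> carrier P" using a B lsoc_P_closed by blast
    have "B = {b \<in> carrier P. same_weight a b}"
    proof (cases "a \<in> lsoc P")
      case True
      then obtain m where "B = {a \<in> lsoc P. \<forall>i<t. wt n S a i = m i}" using a B by blast
      then show ?thesis using a unfolding inn[OF True] by auto
    qed (use a B out in auto)
    then show "B \<in> (\<lambda>a. {b \<in> carrier P. same_weight a b}) ` carrier P" using ac by blast
  next
    fix B assume "B \<in> (\<lambda>a. {b \<in> carrier P. same_weight a b}) ` carrier P"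
    then obtain a where a: "a \<in> carrier P" "B = {b \<in> carrier P. same_weight a b}" by blast
    have "a \<in> B" using a by (simp add: same_weight_def)
    moreover have "B = carrier P - lsoc P \<or> (\<exists>m. in_M t n m \<and> B = {a \<in> lsoc P. \<forall>i<t. wt n S a i = m i})"
    proof (cases "a \<in> lsoc P")
      case True
      have "in_M t n (wt n S a)" by (simp add: in_M_def wt_le)
      then show ?thesis using a(2) inn[OF True] by blast
    qed (use a(2) out in simp)
    ultimately show "B \<in> H' t n S" unfolding H'_def by blast
  qed
qed

section \<open>The relation behind the dual partition\<close>

definition unit_wt :: "(nat \<Rightarrow> nat \<Rightarrow> 'c) \<Rightarrow> nat \<Rightarrow> nat" where
  "unit_wt a i = card {j. j < n i \<and> a i j \<notin> jrad (S i j)}"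

text \<open>All elements of the radical have unit weights 0; the first conjunct separates 0 from the
  others.\<close>

definition same_unit_wt :: "(nat \<Rightarrow> nat \<Rightarrow> 'c) \<Rightarrow> (nat \<Rightarrow> nat \<Rightarrow> 'c) \<Rightarrow> bool" where
  "same_unit_wt a b \<longleftrightarrow> (a = \<zero>\<^bsub>P\<^esub> \<longleftrightarrow> b = \<zero>\<^bsub>P\<^esub>) \<and> (\<forall>i<t. unit_wt a i = unit_wt b i)"

lemma unit_wt_le: "unit_wt a i \<le> n i"
  unfolding unit_wt_def using card_mono[of "{..<n i}" "{j. j < n i \<and> a i j \<notin> jrad (S i j)}"] by auto

lemma jrad_iff_unit_wt: "a \<in> carrier P \<Longrightarrow> a \<in> jrad P \<longleftrightarrow> (\<forall>i<t. unit_wt a i = 0)"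
  unfolding mem_jrad_P by (auto simp: unit_wt_def)

lemma jrad_P_closed: "a \<in> jrad P \<Longrightarrow> a \<in> carrier P"
  by (simp add: jrad_def)

lemma zero_in_jrad_P: "\<zero>\<^bsub>P\<^esub> \<in> jrad P"
  using left_ideal_closed(2)[OF finite_local_ring.jrad_left_ideal[OF component_local]]
  by (simp add: mem_jrad_P P_simps idx_in_idx)

lemma H'_dual_eq_classes: "H'_dual t n S = (\<lambda>a. {b \<in> carrier P. same_unit_wt a b}) ` carrier P"
proof -
  have c0: "{b \<in> carrier P. same_unit_wt \<zero>\<^bsub>P\<^esub> b} = {\<zero>\<^bsub>P\<^esub>}"
    by (auto simp: same_unit_wt_def)
  have c1: "{b \<in> carrier P. same_unit_wt a b} = jrad P - {\<zero>\<^bsub>P\<^esub>}" if "a \<in> jrad P" "a \<noteq> \<zero>\<^bsub>P\<^esub>" for a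
  proof -
    have "b \<in> jrad P \<longleftrightarrow> b \<in> carrier P \<and> (\<forall>i<t. unit_wt b i = 0)" for b
      using jrad_iff_unit_wt jrad_P_closed by blast
    then show ?thesis using that by (auto simp: same_unit_wt_def)
  qed
  have c2: "{b \<in> carrier P. same_unit_wt a b} = {b \<in> carrier P - jrad P. \<forall>i<t. unit_wt b i = unit_wt a i}"
    if "a \<in> carrier P" "a \<notin> jrad P" for a
    using that zero_in_jrad_P by (auto simp: same_unit_wt_def jrad_iff_unit_wt)
  let ?blk = "\<lambda>B. B = jrad P - {\<zero>\<^bsub>P\<^esub>} \<or> B = {\<zero>\<^bsub>P\<^esub>} \<or> (\<exists>m. in_M t n m \<and> (\<exists>i<t. m i \<noteq> 0) \<and>
            B = {a \<in> carrier P - jrad P. \<forall>i<t. unit_wt a i = m i})"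
  have H: "B \<in> H'_dual t n S \<longleftrightarrow> B \<noteq> {} \<and> ?blk B" for B
    unfolding H'_dual_def unit_wt_def by simp
  show ?thesis
  proof (intro equalityI subsetI)
    fix B assume "B \<in> H'_dual t n S"
    then obtain a where a: "a \<in> B" and B: "?blk B" unfolding H by blast
    have ac: "a \<in> carrier P" using a B jrad_P_closed by auto
    have "B = {b \<in> carrier P. same_unit_wt a b}"
      using B
    proof (elim disjE exE conjE)
      assume "B = jrad P - {\<zero>\<^bsub>P\<^esub>}"
      then show ?thesis using a c1[of a] by auto
    next
      assume "B = {\<zero>\<^bsub>P\<^esub>}"
      then show ?thesis using a c0 by auto
    next
      fix m assume m: "B = {a \<in> carrier P - jrad P. \<forall>i<t. unit_wt a i = m i}"
      then have "a \<notin> jrad P" using a by simp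
      then show ?thesis using a m unfolding c2[OF ac \<open>a \<notin> jrad P\<close>] by auto
    qed
    then show "B \<in> (\<lambda>a. {b \<in> carrier P. same_unit_wt a b}) ` carrier P" using ac by blast
  next
    fix B assume "B \<in> (\<lambda>a. {b \<in> carrier P. same_unit_wt a b}) ` carrier P"
    then obtain a where a: "a \<in> carrier P" "B = {b \<in> carrier P. same_unit_wt a b}" by blast
    have "a \<in> B" using a by (simp add: same_unit_wt_def)
    moreover have "?blk B"
    proof (cases "a \<in> jrad P")
      case True then show ?thesis using a c0 c1[of a] by (cases "a = \<zero>\<^bsub>P\<^esub>") auto
    next
      case False
      then have "\<exists>i<t. unit_wt a i \<noteq> 0" using jrad_iff_unit_wt[OF a(1)] by simp
      moreover have "in_M t n (unit_wt a)" by (simp add: in_M_def unit_wt_le)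
      ultimately show ?thesis using a(2) c2[OF a(1) False] by blast
    qed
    ultimately show "B \<in> H'_dual t n S" unfolding H by blast
  qed
qed

section \<open>Character sums and dual partitions\<close>

text \<open>The restriction of the character to one factor of the product.\<close>

definition chi_comp :: "((nat \<Rightarrow> nat \<Rightarrow> 'c) \<Rightarrow> complex) \<Rightarrow> nat \<Rightarrow> nat \<Rightarrow> 'c \<Rightarrow> complex" where
  "chi_comp \<chi> i j x = \<chi> (emb i j x)"

lemma emb_mult_right:
  assumes "in_idx t n i j" "s \<in> carrier (S i j)" "a \<in> carrier P"
  shows "a \<otimes>\<^bsub>P\<^esub> emb i j s = emb i j (a i j \<otimes>\<^bsub>S i j\<^esub> s)"
proof (rule P_eqI)
  show "a \<otimes>\<^bsub>P\<^esub> emb i j s \<in> carrier P" using assms by (simp add: emb_closed)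
  show "emb i j (a i j \<otimes>\<^bsub>S i j\<^esub> s) \<in> carrier P"
    using assms by (simp add: emb_closed carrier_P_component component_simps)
qed (use assms in \<open>auto simp: P_simps emb_def carrier_P_component component_simps\<close>)

context
  fixes \<chi> :: "(nat \<Rightarrow> nat \<Rightarrow> 'c) \<Rightarrow> complex"
  assumes gen: "generating_char P \<chi>"
begin

lemma chi_add: "a \<in> carrier P \<Longrightarrow> b \<in> carrier P \<Longrightarrow> \<chi> (a \<oplus>\<^bsub>P\<^esub> b) = \<chi> a * \<chi> b"
  using gen unfolding generating_char_def add_chars_def by blast

lemma chi_zero: "\<chi> \<zero>\<^bsub>P\<^esub> = 1"
proof -
  have "\<chi> \<zero>\<^bsub>P\<^esub> \<noteq> 0" using gen P.zero_closed unfolding generating_char_def add_chars_def by blast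
  then show ?thesis using chi_add[OF P.zero_closed P.zero_closed] by simp
qed

text \<open>If all these values were 1, then \<open>x\<close> and 0 would induce the same character,
  against the injectivity in \<open>generating_char\<close>.\<close>

lemma chi_left_nontrivial:
  assumes x: "x \<in> carrier P" "x \<noteq> \<zero>\<^bsub>P\<^esub>"
  obtains r where "r \<in> carrier P" "\<chi> (r \<otimes>\<^bsub>P\<^esub> x) \<noteq> 1"
proof -
  have inj: "inj_on (\<lambda>r. restrict (\<lambda>x. \<chi> (x \<otimes>\<^bsub>P\<^esub> r)) (carrier P)) (carrier P)"
    using gen unfolding generating_char_def bij_betw_def by blast
  have "\<exists>r\<in>carrier P. \<chi> (r \<otimes>\<^bsub>P\<^esub> x) \<noteq> 1"
  proof (rule ccontr)
    assume "\<not> ?thesis"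
    then have "restrict (\<lambda>y. \<chi> (y \<otimes>\<^bsub>P\<^esub> x)) (carrier P) = restrict (\<lambda>y. \<chi> (y \<otimes>\<^bsub>P\<^esub> \<zero>\<^bsub>P\<^esub>)) (carrier P)"
      by (intro restrict_ext) (auto simp: chi_zero)
    then show False using inj_onD[OF inj _ x(1) P.zero_closed] x(2) by blast
  qed
  then show ?thesis using that by blast
qed

lemma chi_comp_add:
  "in_idx t n i j \<Longrightarrow> x \<in> carrier (S i j) \<Longrightarrow> y \<in> carrier (S i j) \<Longrightarrow>
    chi_comp \<chi> i j (x \<oplus>\<^bsub>S i j\<^esub> y) = chi_comp \<chi> i j x * chi_comp \<chi> i j y"
  by (simp add: chi_comp_def emb_add chi_add emb_closed)

lemma chi_comp_zero: "in_idx t n i j \<Longrightarrow> chi_comp \<chi> i j \<zero>\<^bsub>S i j\<^esub> = 1"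
  by (simp add: chi_comp_def emb_zero chi_zero)

text \<open>Nondegeneracy passes to each component, because multiplying an embedded element by
  \<open>r\<close> involves only the component \<open>r i j\<close>.\<close>

lemma chi_comp_nontrivial:
  assumes ij: "in_idx t n i j" and x: "x \<in> carrier (S i j)" "x \<noteq> \<zero>\<^bsub>S i j\<^esub>"
  obtains r where "r \<in> carrier (S i j)" "chi_comp \<chi> i j (r \<otimes>\<^bsub>S i j\<^esub> x) \<noteq> 1"
proof -
  have "emb i j x \<noteq> \<zero>\<^bsub>P\<^esub>" using x(2) ij by (auto simp: emb_def P_simps fun_eq_iff)
  then obtain r where r: "r \<in> carrier P" "\<chi> (r \<otimes>\<^bsub>P\<^esub> emb i j x) \<noteq> 1"
    by (rule chi_left_nontrivial[OF emb_closed[OF x(1)]])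
  show ?thesis
    by (rule that[of "r i j"]) (use r emb_mult_right[OF ij x(1) r(1)] carrier_P_component[OF r(1) ij] in \<open>auto simp: chi_comp_def\<close>)
qed

lemma chi_eq_prod:
  assumes a: "a \<in> carrier P"
  shows "\<chi> a = (\<Prod>p\<in>idx t n. chi_comp \<chi> (fst p) (snd p) (a (fst p) (snd p)))"
proof (rule P_component_induct[OF a, of "\<lambda>a. \<chi> a = (\<Prod>p\<in>idx t n. chi_comp \<chi> (fst p) (snd p) (a (fst p) (snd p)))"])
  show "\<chi> \<zero>\<^bsub>P\<^esub> = (\<Prod>p\<in>idx t n. chi_comp \<chi> (fst p) (snd p) (\<zero>\<^bsub>P\<^esub> (fst p) (snd p)))"
    by (simp add: chi_zero P_simps idx_in_idx chi_comp_zero)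
next
  fix i j b
  assume ij: "in_idx t n i j" and b: "b \<in> carrier P" "b i j = \<zero>\<^bsub>S i j\<^esub>"
    and IH: "\<chi> b = (\<Prod>p\<in>idx t n. chi_comp \<chi> (fst p) (snd p) (b (fst p) (snd p)))"
  have mem: "(i, j) \<in> idx t n" using ij by (simp add: in_idx_def)
  have fin: "finite (idx t n)" by simp
  let ?c = "emb i j (a i j) \<oplus>\<^bsub>P\<^esub> b"
  let ?f = "\<lambda>a p. chi_comp \<chi> (fst p) (snd p) (a (fst p) (snd p))"
  have aij: "a i j \<in> carrier (S i j)" by (rule carrier_P_component[OF a ij])
  have cij: "?c i j = a i j" using ij b(2) aij by (simp add: P_simps emb_def component_simps)
  have rest: "?f ?c p = ?f b p" if "p \<in> idx t n - {(i, j)}" for p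
  proof -
    have p: "in_idx t n (fst p) (snd p)" "\<not> (fst p = i \<and> snd p = j)" using that by (auto simp: in_idx_def)
    then have "?c (fst p) (snd p) = b (fst p) (snd p)"
      using carrier_P_component[OF b(1) p(1)] by (auto simp: P_simps emb_def component_simps)
    then show ?thesis by simp
  qed
  have "\<chi> ?c = chi_comp \<chi> i j (a i j) * \<chi> b"
    using chi_add[OF emb_closed[OF aij] b(1)] by (simp add: chi_comp_def)
  \<comment> \<open>The factor of \<open>b\<close> at \<open>(i, j)\<close> is the character value
    at 0, so it may be dropped and replaced by the new component.\<close>
  also have "\<chi> b = (\<Prod>p\<in>idx t n - {(i, j)}. ?f b p)"
    unfolding IH by (subst prod.remove[OF fin mem]) (simp add: b(2) chi_comp_zero[OF ij])
  also have "\<dots> = (\<Prod>p\<in>idx t n - {(i, j)}. ?f ?c p)" by (rule prod.cong) (use rest in auto)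
  also have "chi_comp \<chi> i j (a i j) * \<dots> = (\<Prod>p\<in>idx t n. ?f ?c p)"
    using prod.remove[OF fin mem, of "?f ?c"] by (simp add: cij)
  finally show "\<chi> ?c = (\<Prod>p\<in>idx t n. ?f ?c p)" .
qed

lemma sum_chi_left:
  assumes a: "a \<in> carrier P"
  shows "(\<Sum>b\<in>carrier P. \<chi> (b \<otimes>\<^bsub>P\<^esub> a)) = (if a = \<zero>\<^bsub>P\<^esub> then of_nat (card (carrier P)) else 0)"
proof (cases "a = \<zero>\<^bsub>P\<^esub>")
  case True
  then show ?thesis by (simp add: chi_zero)
next
  case False
  obtain r where r: "r \<in> carrier P" "\<chi> (r \<otimes>\<^bsub>P\<^esub> a) \<noteq> 1" by (rule chi_left_nontrivial[OF a False])
  have "(\<Sum>b\<in>carrier P. \<chi> (b \<otimes>\<^bsub>P\<^esub> a)) = 0"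
    by (rule P.sum_character_eq_0[OF finite_P _ _ _ r(1)])
      (use a r(2) in \<open>auto simp: P.l_distr chi_add\<close>)
  then show ?thesis using False by simp
qed

text \<open>Nondegeneracy on the other side: counting the sum of \<open>\<chi> (a b)\<close> over all \<open>a\<close>, \<open>b\<close> in two ways
  shows that the right kernel and the left kernel of the pairing have the same size.\<close>

lemma sum_chi_right:
  assumes a: "a \<in> carrier P"
  shows "(\<Sum>b\<in>carrier P. \<chi> (a \<otimes>\<^bsub>P\<^esub> b)) = (if a = \<zero>\<^bsub>P\<^esub> then of_nat (card (carrier P)) else 0)"
proof -
  let ?N = "of_nat (card (carrier P)) :: complex"
  define K where "K = {a \<in> carrier P. \<forall>b\<in>carrier P. \<chi> (a \<otimes>\<^bsub>P\<^esub> b) = 1}"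
  have N: "?N \<noteq> 0" using finite_P P.zero_closed by (auto simp: card_eq_0_iff)
  have row: "(\<Sum>b\<in>carrier P. \<chi> (a \<otimes>\<^bsub>P\<^esub> b)) = (if a \<in> K then ?N else 0)" if a: "a \<in> carrier P" for a
  proof (cases "a \<in> K")
    case True
    then show ?thesis by (simp add: K_def)
  next
    case False
    then obtain r where r: "r \<in> carrier P" "\<chi> (a \<otimes>\<^bsub>P\<^esub> r) \<noteq> 1" using a by (auto simp: K_def)
    have "(\<Sum>b\<in>carrier P. \<chi> (a \<otimes>\<^bsub>P\<^esub> b)) = 0"
      by (rule P.sum_character_eq_0[OF finite_P _ _ _ r(1)])
        (use a r(2) in \<open>auto simp: P.r_distr chi_add\<close>)
    then show ?thesis using False by simp
  qed
  have Ksub: "K \<subseteq> carrier P" by (auto simp: K_def)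
  then have "of_nat (card K) * ?N = (\<Sum>a\<in>carrier P. if a \<in> K then ?N else 0)"
    by (simp add: sum.If_cases finite_P Int_absorb1)
  also have "\<dots> = (\<Sum>a\<in>carrier P. \<Sum>b\<in>carrier P. \<chi> (a \<otimes>\<^bsub>P\<^esub> b))"
    by (rule sum.cong) (use row in auto)
  also have "\<dots> = (\<Sum>b\<in>carrier P. \<Sum>a\<in>carrier P. \<chi> (a \<otimes>\<^bsub>P\<^esub> b))" by (rule sum.swap)
  also have "\<dots> = (\<Sum>b\<in>carrier P. if b = \<zero>\<^bsub>P\<^esub> then ?N else 0)"
    by (rule sum.cong) (use sum_chi_left in auto)
  also have "\<dots> = ?N" using finite_P by simp
  finally have "card K = 1" using N by simp
  moreover have "\<zero>\<^bsub>P\<^esub> \<in> K" by (simp add: K_def chi_zero)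
  ultimately have "K = {\<zero>\<^bsub>P\<^esub>}" by (auto simp: card_1_singleton_iff)
  then show ?thesis using row[OF a] by simp
qed

text \<open>A radical \<open>x\<close> kills the socle, so all \<open>q i - 1\<close> terms are 1. A
  unit \<open>x\<close> makes the character nontrivial on the socle, so the full sum vanishes and
  removing the term at 0 leaves -1. These are the two Krawtchouk entries.\<close>

lemma sum_chi_comp_lsoc:
  assumes ij: "in_idx t n i j" and x: "x \<in> carrier (S i j)"
  shows "(\<Sum>y\<in>lsoc (S i j) - {\<zero>\<^bsub>S i j\<^esub>}. chi_comp \<chi> i j (x \<otimes>\<^bsub>S i j\<^esub> y))
      = (if x \<notin> jrad (S i j) then - 1 else of_nat (q i) - 1)" (is "?right")
    and "(\<Sum>y\<in>lsoc (S i j) - {\<zero>\<^bsub>S i j\<^esub>}. chi_comp \<chi> i j (y \<otimes>\<^bsub>S i j\<^esub> x))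
      = (if x \<notin> jrad (S i j) then - 1 else of_nat (q i) - 1)" (is "?left")
proof -
  interpret C: simple_socle_ring "S i j" by (rule component[OF ij])
  let ?L = "lsoc (S i j)"
  obtain z where z: "z \<in> ?L" "z \<noteq> \<zero>\<^bsub>S i j\<^esub>" by (rule C.lsoc_nonzero)
  then obtain r where r: "r \<in> carrier (S i j)" "chi_comp \<chi> i j (r \<otimes>\<^bsub>S i j\<^esub> z) \<noteq> 1"
    using chi_comp_nontrivial[OF ij C.lsoc_closed] by metis
  \<comment> \<open>A socle element at which the component character is not 1; \<open>z\<close> is
    moved within the socle by \<open>r\<close>.\<close>
  define c where "c = r \<otimes>\<^bsub>S i j\<^esub> z"
  have c: "c \<in> ?L" "chi_comp \<chi> i j c \<noteq> 1"
    using left_ideal_closed(4)[OF C.lsoc_left_ideal r(1) z(1)] r(2) by (simp_all add: c_def)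
  have cc: "c \<in> carrier (S i j)" by (rule C.lsoc_closed[OF c(1)])
  have rem: "(\<Sum>y\<in>?L - {\<zero>\<^bsub>S i j\<^esub>}. g y) = (\<Sum>y\<in>?L. g y) - g \<zero>\<^bsub>S i j\<^esub>" for g :: "'c \<Rightarrow> complex"
    using sum.remove[OF finite_lsoc[OF ij] zero_in_lsoc[OF ij], of g] by simp
  note zero = chi_comp_zero[OF ij] and qc = card_lsoc[OF ij]
  have subL: "?L \<subseteq> carrier (S i j)" using C.lsoc_closed by blast
  note addL = left_ideal_closed(3)[OF C.lsoc_left_ideal]
  show ?right
  proof (cases "x \<in> jrad (S i j)")
    case True
    then have "x \<otimes>\<^bsub>S i j\<^esub> y = \<zero>\<^bsub>S i j\<^esub>" if "y \<in> ?L" for y using that by (simp add: C.lsoc_eq)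
    then show ?thesis using True x unfolding rem by (simp add: zero qc)
  next
    case False
    then obtain u where u: "u \<in> carrier (S i j)" "x \<otimes>\<^bsub>S i j\<^esub> u = \<one>\<^bsub>S i j\<^esub>"
      using C.inverse_if_notin_jrad x by blast
    \<comment> \<open>Left multiplication by \<open>x\<close> sends this socle element to
      \<open>c\<close>, so the twisted character is nontrivial on the socle.\<close>
    have uc: "u \<otimes>\<^bsub>S i j\<^esub> c \<in> ?L" by (rule left_ideal_closed(4)[OF C.lsoc_left_ideal u(1) c(1)])
    have "x \<otimes>\<^bsub>S i j\<^esub> (u \<otimes>\<^bsub>S i j\<^esub> c) = c" using u x cc by (simp add: C.m_assoc[symmetric])
    then have "(\<Sum>y\<in>?L. chi_comp \<chi> i j (x \<otimes>\<^bsub>S i j\<^esub> y)) = 0"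
      by (intro C.sum_character_eq_0[OF finite_lsoc[OF ij] subL addL _ uc])
        (use x c(2) C.lsoc_closed in \<open>simp_all add: C.r_distr chi_comp_add[OF ij]\<close>)
    then show ?thesis using False x unfolding rem by (simp add: zero)
  qed
  show ?left
  proof (cases "x \<in> jrad (S i j)")
    case True
    then have "y \<otimes>\<^bsub>S i j\<^esub> x = \<zero>\<^bsub>S i j\<^esub>" if "y \<in> ?L" for y using that by (simp add: C.lsoc_mult_jrad)
    then show ?thesis using True x unfolding rem by (simp add: zero qc)
  next
    case False
    then obtain u where u: "u \<in> carrier (S i j)" "u \<otimes>\<^bsub>S i j\<^esub> x = \<one>\<^bsub>S i j\<^esub>"
      using C.inverse_if_notin_jrad x by blast
    have uc: "c \<otimes>\<^bsub>S i j\<^esub> u \<in> ?L" by (rule C.lsoc_mult_right[OF c(1) u(1)])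
    have "(c \<otimes>\<^bsub>S i j\<^esub> u) \<otimes>\<^bsub>S i j\<^esub> x = c" using u x cc by (simp add: C.m_assoc)
    then have "(\<Sum>y\<in>?L. chi_comp \<chi> i j (y \<otimes>\<^bsub>S i j\<^esub> x)) = 0"
      by (intro C.sum_character_eq_0[OF finite_lsoc[OF ij] subL addL _ uc])
        (use x c(2) C.lsoc_closed in \<open>simp_all add: C.l_distr chi_comp_add[OF ij]\<close>)
    then show ?thesis using False x unfolding rem by (simp add: zero)
  qed
qed

text \<open>The character \<open>y \<mapsto> \<chi>(y x)\<close> is trivial on the radical exactly
  when the radical kills \<open>x\<close>, that is, when \<open>x\<close> is in the socle. The sums
  over the complement follow by subtraction from the whole ring. On the socle they are the
  Krawtchouk entries scaled by the size of the radical.\<close>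

lemma sum_chi_comp_jrad:
  assumes ij: "in_idx t n i j" and x: "x \<in> carrier (S i j)"
  shows "(\<Sum>y\<in>jrad (S i j). chi_comp \<chi> i j (y \<otimes>\<^bsub>S i j\<^esub> x))
      = (if x \<in> lsoc (S i j) then of_nat (card (jrad (S i j))) else 0)" (is ?jrad)
    and "x \<in> lsoc (S i j) \<Longrightarrow> (\<Sum>y\<in>carrier (S i j) - jrad (S i j). chi_comp \<chi> i j (y \<otimes>\<^bsub>S i j\<^esub> x))
      = of_nat (card (jrad (S i j))) * (if x \<noteq> \<zero>\<^bsub>S i j\<^esub> then - 1 else of_nat (q i) - 1)"
    and "x \<notin> lsoc (S i j) \<Longrightarrow> (\<Sum>y\<in>carrier (S i j) - jrad (S i j). chi_comp \<chi> i j (y \<otimes>\<^bsub>S i j\<^esub> x)) = 0"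
proof -
  interpret C: simple_socle_ring "S i j" by (rule component[OF ij])
  let ?J = "jrad (S i j)"
  let ?g = "\<lambda>y. chi_comp \<chi> i j (y \<otimes>\<^bsub>S i j\<^esub> x)"
  have subJ: "?J \<subseteq> carrier (S i j)" using C.jrad_closed by blast
  have finJ: "finite ?J" by (rule finite_subset[OF subJ C.finite_carrier])
  show J: ?jrad
  proof (cases "x \<in> lsoc (S i j)")
    case True
    then show ?thesis by (simp add: C.lsoc_eq chi_comp_zero[OF ij])
  next
    case False
    then obtain s where s: "s \<in> ?J" "s \<otimes>\<^bsub>S i j\<^esub> x \<noteq> \<zero>\<^bsub>S i j\<^esub>" using x by (auto simp: C.lsoc_eq)
    have sc: "s \<in> carrier (S i j)" by (rule C.jrad_closed[OF s(1)])
    then obtain r where r: "r \<in> carrier (S i j)" "chi_comp \<chi> i j (r \<otimes>\<^bsub>S i j\<^esub> (s \<otimes>\<^bsub>S i j\<^esub> x)) \<noteq> 1"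
      using chi_comp_nontrivial[OF ij _ s(2)] x by auto
    have rs: "r \<otimes>\<^bsub>S i j\<^esub> s \<in> ?J" by (rule left_ideal_closed(4)[OF C.jrad_left_ideal r(1) s(1)])
    have "(r \<otimes>\<^bsub>S i j\<^esub> s) \<otimes>\<^bsub>S i j\<^esub> x = r \<otimes>\<^bsub>S i j\<^esub> (s \<otimes>\<^bsub>S i j\<^esub> x)" by (rule C.m_assoc[OF r(1) sc x])
    then have "(\<Sum>y\<in>?J. ?g y) = 0"
      by (intro C.sum_character_eq_0[OF finJ subJ left_ideal_closed(3)[OF C.jrad_left_ideal] _ rs])
        (use x r(2) C.jrad_closed in \<open>simp_all add: C.l_distr chi_comp_add[OF ij]\<close>)
    then show ?thesis using False by simp
  qed
  have total: "(\<Sum>y\<in>carrier (S i j). ?g y) = (if x = \<zero>\<^bsub>S i j\<^esub> then of_nat (card (carrier (S i j))) else 0)"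
  proof (cases "x = \<zero>\<^bsub>S i j\<^esub>")
    case True
    then show ?thesis by (simp add: chi_comp_zero[OF ij])
  next
    case False
    obtain r where r: "r \<in> carrier (S i j)" "chi_comp \<chi> i j (r \<otimes>\<^bsub>S i j\<^esub> x) \<noteq> 1"
      by (rule chi_comp_nontrivial[OF ij x False])
    have "(\<Sum>y\<in>carrier (S i j). ?g y) = 0"
      by (rule C.sum_character_eq_0[OF C.finite_carrier _ _ _ r(1)])
        (use x r(2) in \<open>auto simp: C.l_distr chi_comp_add[OF ij]\<close>)
    then show ?thesis using False by simp
  qed
  have diff: "(\<Sum>y\<in>carrier (S i j) - ?J. ?g y) = (\<Sum>y\<in>carrier (S i j). ?g y) - (\<Sum>y\<in>?J. ?g y)"
    by (rule sum_diff[OF C.finite_carrier subJ])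
  \<comment> \<open>For \<open>x\<close> zero the difference is the ring size minus the radical
    size, which this turns into the radical size times \<open>q i - 1\<close>.\<close>
  have card: "card (carrier (S i j)) = card ?J * q i"
    using C.card_carrier card_lsoc[OF ij] by simp
  show "(\<Sum>y\<in>carrier (S i j) - ?J. ?g y) = of_nat (card ?J) * (if x \<noteq> \<zero>\<^bsub>S i j\<^esub> then - 1 else of_nat (q i) - 1)"
    if "x \<in> lsoc (S i j)"
    unfolding diff total J using that by (simp add: card algebra_simps)
  show "(\<Sum>y\<in>carrier (S i j) - ?J. ?g y) = 0" if "x \<notin> lsoc (S i j)"
    unfolding diff total J using that zero_in_lsoc[OF ij] by auto
qed

end

section \<open>Sums over the blocks of \<open>H'\<close>, for an abstract pairing covering both
  sides\<close>

lemma sum_weight_class: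
  fixes \<beta> :: "(nat \<Rightarrow> nat \<Rightarrow> 'c) \<Rightarrow> (nat \<Rightarrow> nat \<Rightarrow> 'c) \<Rightarrow> complex"
  assumes split: "\<And>b. b \<in> carrier P \<Longrightarrow>
      \<beta> a b = (\<Prod>p\<in>idx t n. \<gamma> (fst p) (snd p) (a (fst p) (snd p)) (b (fst p) (snd p)))"
    and zero: "\<And>i j. in_idx t n i j \<Longrightarrow> \<gamma> i j (a i j) \<zero>\<^bsub>S i j\<^esub> = 1"
    and soc: "\<And>i j. in_idx t n i j \<Longrightarrow> (\<Sum>y\<in>lsoc (S i j) - {\<zero>\<^bsub>S i j\<^esub>}. \<gamma> i j (a i j) y)
        = (if a i j \<notin> jrad (S i j) then - 1 else of_nat (q i) - 1)"
  shows "(\<Sum>b\<in>{b \<in> lsoc P. \<forall>i<t. wt n S b i = m i}. \<beta> a b)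
      = krawtchouk t n m (\<lambda>i j. if a i j \<notin> jrad (S i j) then - 1 else of_nat (q i) - 1)"
proof -
  let ?Z = "\<lambda>i j. {\<zero>\<^bsub>S i j\<^esub>}" and ?N = "\<lambda>i j. lsoc (S i j) - {\<zero>\<^bsub>S i j\<^esub>}"
  let ?B = "{b \<in> box t n (\<lambda>i j. ?Z i j \<union> ?N i j). \<forall>i<t. card {j. j < n i \<and> b i j \<in> ?N i j} = m i}"
  have box: "box t n (\<lambda>i j. ?Z i j \<union> ?N i j) = lsoc P"
  proof -
    have "?Z i j \<union> ?N i j = lsoc (S i j)" if "in_idx t n i j" for i j using zero_in_lsoc[OF that] by blast
    then show ?thesis unfolding lsoc_P box_def by (intro Collect_cong) metis
  qed
  have "card {j. j < n i \<and> b i j \<in> ?N i j} = wt n S b i" if "b \<in> lsoc P" "i < t" for b i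
  proof -
    have "{j. j < n i \<and> b i j \<in> ?N i j} = {j. j < n i \<and> b i j \<noteq> \<zero>\<^bsub>S i j\<^esub>}"
      using that unfolding lsoc_P mem_box by blast
    then show ?thesis by (simp add: wt_def)
  qed
  then have B: "{b \<in> lsoc P. \<forall>i<t. wt n S b i = m i} = ?B" unfolding box by auto
  have "(\<Sum>b\<in>?B. \<beta> a b) = (\<Sum>b\<in>?B. \<Prod>p\<in>idx t n. \<gamma> (fst p) (snd p) (a (fst p) (snd p)) (b (fst p) (snd p)))"
    by (rule sum.cong) (use split lsoc_P_closed box in auto)
  also have "\<dots> = (\<Sum>U\<in>supports t n m. (\<Prod>p\<in>U. \<Sum>b\<in>?N (fst p) (snd p). \<gamma> (fst p) (snd p) (a (fst p) (snd p)) b)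
            * (\<Prod>p\<in>idx t n - U. \<Sum>b\<in>?Z (fst p) (snd p). \<gamma> (fst p) (snd p) (a (fst p) (snd p)) b))"
    by (rule sum_weight_block[of t n ?Z ?N "\<lambda>i j. \<gamma> i j (a i j)"]) (auto simp: finite_lsoc in_idx_def)
  also have "\<dots> = (\<Sum>U\<in>supports t n m. \<Prod>p\<in>U. if a (fst p) (snd p) \<notin> jrad (S (fst p) (snd p)) then - 1 else of_nat (q (fst p)) - 1)"
  proof (rule sum.cong[OF refl])
    fix U assume "U \<in> supports t n m"
    then have U: "U \<subseteq> idx t n" by (simp add: supports_def)
    have "(\<Prod>p\<in>U. \<Sum>b\<in>?N (fst p) (snd p). \<gamma> (fst p) (snd p) (a (fst p) (snd p)) b)
        = (\<Prod>p\<in>U. if a (fst p) (snd p) \<notin> jrad (S (fst p) (snd p)) then - 1 else of_nat (q (fst p)) - 1)"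
      by (rule prod.cong[OF refl], rule soc, rule idx_in_idx) (use U in blast)
    moreover have "(\<Prod>p\<in>idx t n - U. \<Sum>b\<in>?Z (fst p) (snd p). \<gamma> (fst p) (snd p) (a (fst p) (snd p)) b) = 1"
      by (rule prod.neutral) (simp add: zero idx_in_idx)
    ultimately show "(\<Prod>p\<in>U. \<Sum>b\<in>?N (fst p) (snd p). \<gamma> (fst p) (snd p) (a (fst p) (snd p)) b)
            * (\<Prod>p\<in>idx t n - U. \<Sum>b\<in>?Z (fst p) (snd p). \<gamma> (fst p) (snd p) (a (fst p) (snd p)) b)
        = (\<Prod>p\<in>U. if a (fst p) (snd p) \<notin> jrad (S (fst p) (snd p)) then - 1 else of_nat (q (fst p)) - 1)"
      by simp
  qed
  finally show ?thesis unfolding B krawtchouk_def .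
qed

text \<open>Adding the value 1 at 0 to the component sums gives 0 at a nonradical position and
  \<open>q i\<close> at a radical one, so one nonradical component annihilates the product.\<close>

lemma sum_lsoc_P:
  fixes \<beta> :: "(nat \<Rightarrow> nat \<Rightarrow> 'c) \<Rightarrow> (nat \<Rightarrow> nat \<Rightarrow> 'c) \<Rightarrow> complex"
  assumes a: "a \<in> carrier P" and split: "\<And>b. b \<in> carrier P \<Longrightarrow>
      \<beta> a b = (\<Prod>p\<in>idx t n. \<gamma> (fst p) (snd p) (a (fst p) (snd p)) (b (fst p) (snd p)))"
    and zero: "\<And>i j. in_idx t n i j \<Longrightarrow> \<gamma> i j (a i j) \<zero>\<^bsub>S i j\<^esub> = 1"
    and soc: "\<And>i j. in_idx t n i j \<Longrightarrow> (\<Sum>y\<in>lsoc (S i j) - {\<zero>\<^bsub>S i j\<^esub>}. \<gamma> i j (a i j) y)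
        = (if a i j \<notin> jrad (S i j) then - 1 else of_nat (q i) - 1)"
  shows "(\<Sum>b\<in>lsoc P. \<beta> a b) = (if a \<in> jrad P then \<Prod>p\<in>idx t n. of_nat (q (fst p)) else 0)"
proof -
  have "(\<Sum>b\<in>lsoc P. \<beta> a b) = (\<Sum>b\<in>box t n (\<lambda>i j. lsoc (S i j)). \<Prod>p\<in>idx t n. \<gamma> (fst p) (snd p) (a (fst p) (snd p)) (b (fst p) (snd p)))"
    by (rule sum.cong) (use split lsoc_P_closed lsoc_P in auto)
  also have "\<dots> = (\<Prod>p\<in>idx t n. \<Sum>b\<in>lsoc (S (fst p) (snd p)). \<gamma> (fst p) (snd p) (a (fst p) (snd p)) b)"
    by (rule sum_box_prod[of t n _ "\<lambda>i j. \<gamma> i j (a i j)"]) (simp add: finite_lsoc in_idx_def)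
  also have "\<dots> = (\<Prod>p\<in>idx t n. if a (fst p) (snd p) \<notin> jrad (S (fst p) (snd p)) then 0 else of_nat (q (fst p)))"
  proof (rule prod.cong[OF refl])
    fix p assume "p \<in> idx t n"
    then have p: "in_idx t n (fst p) (snd p)" by (rule idx_in_idx)
    show "(\<Sum>b\<in>lsoc (S (fst p) (snd p)). \<gamma> (fst p) (snd p) (a (fst p) (snd p)) b)
        = (if a (fst p) (snd p) \<notin> jrad (S (fst p) (snd p)) then 0 else of_nat (q (fst p)))"
      unfolding sum.remove[OF finite_lsoc[OF p] zero_in_lsoc[OF p]] zero[OF p] soc[OF p] by simp
  qed
  also have "\<dots> = (if a \<in> jrad P then \<Prod>p\<in>idx t n. of_nat (q (fst p)) else 0)"
  proof (cases "a \<in> jrad P")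
    case True
    then show ?thesis unfolding mem_jrad_P[OF a] by (auto intro!: prod.cong)
  next
    case False
    then obtain p where p: "p \<in> idx t n" "a (fst p) (snd p) \<notin> jrad (S (fst p) (snd p))"
      unfolding mem_jrad_P[OF a] by blast
    then have "\<exists>p\<in>idx t n. (if a (fst p) (snd p) \<notin> jrad (S (fst p) (snd p)) then 0 else of_nat (q (fst p))) = (0 :: complex)"
      by (intro bexI[OF _ p(1)]) simp
    then show ?thesis using False by (subst prod_zero) simp_all
  qed
  finally show ?thesis .
qed

lemma q_nonzero: "i < t \<Longrightarrow> 0 < n i \<Longrightarrow> q i \<noteq> 0"
  using q_ge_2[of i 0] by (simp add: in_idx_def)

lemma krawtchouk_unit_inj:
  assumes k: "k < t" and eq: "krawtchouk t n (\<lambda>i. if i = k then 1 else 0) (\<lambda>i j. if T i j then - 1 else of_nat (q i) - 1 :: complex)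
     = krawtchouk t n (\<lambda>i. if i = k then 1 else 0) (\<lambda>i j. if T' i j then - 1 else of_nat (q i) - 1)"
  shows "card {j. j < n k \<and> T k j} = card {j. j < n k \<and> T' k j}"
proof (cases "n k = 0")
  case False
  then have "q k \<noteq> 0" using q_nonzero k by simp
  then show ?thesis using eq unfolding krawtchouk_unit_eq[OF k] by simp
qed simp

text \<open>The pairing \<open>\<beta>\<close> and its factors \<open>\<gamma>\<close> are left
  abstract so that both orders of multiplication are covered. From left to right, the weight-one
  blocks give the unit weights, and the block outside the socle then decides whether the element is
  0.\<close>

lemma dual_weight_classes_iff:
  fixes \<beta> :: "(nat \<Rightarrow> nat \<Rightarrow> 'c) \<Rightarrow> (nat \<Rightarrow> nat \<Rightarrow> 'c) \<Rightarrow> complex"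
  assumes split: "\<And>a b. a \<in> carrier P \<Longrightarrow> b \<in> carrier P \<Longrightarrow>
      \<beta> a b = (\<Prod>p\<in>idx t n. \<gamma> (fst p) (snd p) (a (fst p) (snd p)) (b (fst p) (snd p)))"
    and zero: "\<And>i j x. in_idx t n i j \<Longrightarrow> x \<in> carrier (S i j) \<Longrightarrow> \<gamma> i j x \<zero>\<^bsub>S i j\<^esub> = 1"
    and soc: "\<And>i j x. in_idx t n i j \<Longrightarrow> x \<in> carrier (S i j) \<Longrightarrow>
        (\<Sum>y\<in>lsoc (S i j) - {\<zero>\<^bsub>S i j\<^esub>}. \<gamma> i j x y) = (if x \<notin> jrad (S i j) then - 1 else of_nat (q i) - 1)"
    and total: "\<And>a. a \<in> carrier P \<Longrightarrow>
        (\<Sum>b\<in>carrier P. \<beta> a b) = (if a = \<zero>\<^bsub>P\<^esub> then of_nat (card (carrier P)) else 0)"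
    and aa': "a \<in> carrier P" "a' \<in> carrier P"
  shows "(\<forall>B\<in>H' t n S. (\<Sum>b\<in>B. \<beta> a b) = (\<Sum>b\<in>B. \<beta> a' b)) \<longleftrightarrow> same_unit_wt a a'"
proof -
  define K where "K m a = krawtchouk t n m (\<lambda>i j. if a i j \<notin> jrad (S i j) then - 1 else of_nat (q i) - 1 :: complex)" for m a
  have blk: "(\<Sum>b\<in>{b \<in> lsoc P. \<forall>i<t. wt n S b i = m i}. \<beta> a b) = K m a" if "a \<in> carrier P" for m a
    unfolding K_def using that by (intro sum_weight_class[where \<gamma> = \<gamma>] split zero soc carrier_P_component)
  have socs: "(\<Sum>b\<in>lsoc P. \<beta> a b) = (if a \<in> jrad P then \<Prod>p\<in>idx t n. of_nat (q (fst p)) else 0)"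
    if "a \<in> carrier P" for a
    using that by (intro sum_lsoc_P[where \<gamma> = \<gamma>] split zero soc carrier_P_component)
  have out: "(\<Sum>b\<in>carrier P - lsoc P. \<beta> a b) = (if a = \<zero>\<^bsub>P\<^esub> then of_nat (card (carrier P)) else 0)
      - (if a \<in> jrad P then \<Prod>p\<in>idx t n. of_nat (q (fst p)) else 0)" if "a \<in> carrier P" for a
    using sum_diff[OF finite_P, of "lsoc P" "\<beta> a"] lsoc_P_closed unfolding total[OF that] socs[OF that] by blast
  have N: "card (carrier P) \<noteq> 0" using finite_P P.zero_closed by (auto simp: card_eq_0_iff)
  show ?thesis
  proof
    assume same: "same_unit_wt a a'"
    have Keq: "K m a = K m a'" for m
      unfolding K_def by (rule krawtchouk_cong) (use same in \<open>simp add: same_unit_wt_def unit_wt_def\<close>)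
    have jr: "a \<in> jrad P \<longleftrightarrow> a' \<in> jrad P"
      using same unfolding jrad_iff_unit_wt[OF aa'(1)] jrad_iff_unit_wt[OF aa'(2)] same_unit_wt_def by auto
    show "\<forall>B\<in>H' t n S. (\<Sum>b\<in>B. \<beta> a b) = (\<Sum>b\<in>B. \<beta> a' b)"
    proof
      fix B assume "B \<in> H' t n S"
      then consider "B = carrier P - lsoc P" | m where "B = {b \<in> lsoc P. \<forall>i<t. wt n S b i = m i}"
        unfolding H'_def by blast
      then show "(\<Sum>b\<in>B. \<beta> a b) = (\<Sum>b\<in>B. \<beta> a' b)"
      proof cases
        case 1
        show ?thesis unfolding 1 out[OF aa'(1)] out[OF aa'(2)]
          using jr same by (simp add: same_unit_wt_def)
      next
        case 2
        show ?thesis unfolding 2 blk[OF aa'(1)] blk[OF aa'(2)] by (rule Keq)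
      qed
    qed
  next
    assume eq: "\<forall>B\<in>H' t n S. (\<Sum>b\<in>B. \<beta> a b) = (\<Sum>b\<in>B. \<beta> a' b)"
    have uw: "unit_wt a k = unit_wt a' k" if k: "k < t" for k
    proof (cases "n k = 0")
      case False
      let ?m = "\<lambda>i. if i = k then 1 else 0 :: nat"
      let ?B = "{b \<in> lsoc P. \<forall>i<t. wt n S b i = ?m i}"
      have "(\<Sum>b\<in>?B. \<beta> a b) = (\<Sum>b\<in>?B. \<beta> a' b)"
      \<comment> \<open>\<open>H'\<close> has no empty blocks, so an empty \<open>?B\<close> is not
        covered by \<open>eq\<close>, but then both sums are 0.\<close>
      proof (cases "?B = {}")
        case nonempty: False
        have "in_M t n ?m" using False by (auto simp: in_M_def)
        then have "?B \<in> H' t n S" using nonempty unfolding H'_def by blast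
        then show ?thesis using eq by blast
      qed (simp only: sum.empty)
      then show ?thesis
        unfolding blk[OF aa'(1)] blk[OF aa'(2)] K_def unit_wt_def by (rule krawtchouk_unit_inj[OF k])
    qed (simp add: unit_wt_def)
    then have jr: "a \<in> jrad P \<longleftrightarrow> a' \<in> jrad P"
      unfolding jrad_iff_unit_wt[OF aa'(1)] jrad_iff_unit_wt[OF aa'(2)] by auto
    have "(\<Sum>b\<in>carrier P - lsoc P. \<beta> a b) = (\<Sum>b\<in>carrier P - lsoc P. \<beta> a' b)"
    proof (cases "carrier P - lsoc P = {}")
      case False
      then have "carrier P - lsoc P \<in> H' t n S" unfolding H'_def by blast
      then show ?thesis using eq by blast
    qed (simp only: sum.empty)
    \<comment> \<open>Radical membership already agrees, so the two sums can differ only by the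
      nonzero term for the ring size, which is present exactly at 0.\<close>
    then have "a = \<zero>\<^bsub>P\<^esub> \<longleftrightarrow> a' = \<zero>\<^bsub>P\<^esub>"
      unfolding out[OF aa'(1)] out[OF aa'(2)] using jr N by (auto split: if_splits)
    then show "same_unit_wt a a'" using uw by (simp add: same_unit_wt_def)
  qed
qed

lemma chi_mult_split:
  assumes gen: "generating_char P \<chi>" and ab: "a \<in> carrier P" "b \<in> carrier P"
  shows "\<chi> (a \<otimes>\<^bsub>P\<^esub> b) = (\<Prod>p\<in>idx t n. chi_comp \<chi> (fst p) (snd p)
      (a (fst p) (snd p) \<otimes>\<^bsub>S (fst p) (snd p)\<^esub> b (fst p) (snd p)))"
  unfolding chi_eq_prod[OF gen P.m_closed[OF ab]]
  by (rule prod.cong) (simp_all add: P_simps idx_in_idx)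

lemma dual_H':
  assumes gen: "generating_char P \<chi>"
  shows "right_dual P \<chi> (H' t n S) = H'_dual t n S"
    and "left_dual P \<chi> (H' t n S) = H'_dual t n S"
proof -
  have r: "(\<forall>B\<in>H' t n S. (\<Sum>b\<in>B. \<chi> (a \<otimes>\<^bsub>P\<^esub> b)) = (\<Sum>b\<in>B. \<chi> (a' \<otimes>\<^bsub>P\<^esub> b))) \<longleftrightarrow> same_unit_wt a a'"
    if "a \<in> carrier P" "a' \<in> carrier P" for a a'
  by (rule dual_weight_classes_iff[of "\<lambda>a b. \<chi> (a \<otimes>\<^bsub>P\<^esub> b)" "\<lambda>i j x y. chi_comp \<chi> i j (x \<otimes>\<^bsub>S i j\<^esub> y)", OF _ _ _ sum_chi_right[OF gen] that])
      (simp_all add: chi_mult_split[OF gen] sum_chi_comp_lsoc[OF gen] component_simps chi_comp_zero[OF gen])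
  have l: "(\<forall>B\<in>H' t n S. (\<Sum>b\<in>B. \<chi> (b \<otimes>\<^bsub>P\<^esub> a)) = (\<Sum>b\<in>B. \<chi> (b \<otimes>\<^bsub>P\<^esub> a'))) \<longleftrightarrow> same_unit_wt a a'"
    if "a \<in> carrier P" "a' \<in> carrier P" for a a'
  by (rule dual_weight_classes_iff[of "\<lambda>a b. \<chi> (b \<otimes>\<^bsub>P\<^esub> a)" "\<lambda>i j x y. chi_comp \<chi> i j (y \<otimes>\<^bsub>S i j\<^esub> x)", OF _ _ _ sum_chi_left[OF gen] that])
      (simp_all add: chi_mult_split[OF gen] sum_chi_comp_lsoc[OF gen] component_simps chi_comp_zero[OF gen])
  show "right_dual P \<chi> (H' t n S) = H'_dual t n S"
    unfolding right_dual_def H'_dual_eq_classes by (intro image_cong refl) (use r in blast)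
  show "left_dual P \<chi> (H' t n S) = H'_dual t n S"
    unfolding left_dual_def H'_dual_eq_classes by (intro image_cong refl) (use l in blast)
qed

text \<open>Only products \<open>b \<otimes> a\<close> occur, since reflexivity takes the left dual
  of the right dual. Radical and socle exchange roles with respect to
  \<open>dual_weight_classes_iff\<close>: sums vanish off the socle, and on it they are Krawtchouk
  values times the size \<open>J\<close> of the radical.\<close>

lemma dual_unit_wt_classes_iff:
  assumes gen: "generating_char P \<chi>" and aa': "a \<in> carrier P" "a' \<in> carrier P"
  shows "(\<forall>B\<in>H'_dual t n S. (\<Sum>b\<in>B. \<chi> (b \<otimes>\<^bsub>P\<^esub> a)) = (\<Sum>b\<in>B. \<chi> (b \<otimes>\<^bsub>P\<^esub> a'))) \<longleftrightarrow> same_weight a a'"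
proof -
  let ?Z = "\<lambda>i j. jrad (S i j)" and ?N = "\<lambda>i j. carrier (S i j) - jrad (S i j)"
  let ?g = "\<lambda>a i j y. chi_comp \<chi> i j (y \<otimes>\<^bsub>S i j\<^esub> a i j)"
  define J :: complex where "J = (\<Prod>p\<in>idx t n. of_nat (card (jrad (S (fst p) (snd p)))))"
  define K where "K m a = krawtchouk t n m (\<lambda>i j. if a i j \<noteq> \<zero>\<^bsub>S i j\<^esub> then - 1 else of_nat (q i) - 1 :: complex)" for m a
  \<comment> \<open>Without excluding the radical, \<open>Q m\<close> is a full weight block and its
    sum factors. For nonzero \<open>m\<close> it is a block of the dual partition, as
    \<open>Qblock\<close> shows.\<close>
  define Q where "Q m = {b \<in> carrier P. \<forall>i<t. unit_wt b i = m i}" for m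
  have finJ: "finite (jrad (S i j))" if "in_idx t n i j" for i j
    using finite_local_ring.jrad_closed[OF component_local[OF that]] finite_component[OF that]
    by (meson finite_subset subsetI)
  have cardJ: "card (jrad (S i j)) \<noteq> 0" if "in_idx t n i j" for i j
    using finJ[OF that] left_ideal_closed(2)[OF finite_local_ring.jrad_left_ideal[OF component_local[OF that]]]
    by (auto simp: card_eq_0_iff)
  have J: "J \<noteq> 0" using cardJ[unfolded in_idx_def] by (auto simp: J_def)
  have spl: "\<chi> (b \<otimes>\<^bsub>P\<^esub> a) = (\<Prod>p\<in>idx t n. ?g a (fst p) (snd p) (b (fst p) (snd p)))"
    if "a \<in> carrier P" "b \<in> carrier P" for a b
    by (rule chi_mult_split[OF gen that(2,1)])
  have jr: "(\<Sum>b\<in>jrad P. \<chi> (b \<otimes>\<^bsub>P\<^esub> a)) = (if a \<in> lsoc P then J else 0)" if a: "a \<in> carrier P" for a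
  proof -
    have "(\<Sum>b\<in>jrad P. \<chi> (b \<otimes>\<^bsub>P\<^esub> a)) = (\<Sum>b\<in>box t n ?Z. \<Prod>p\<in>idx t n. ?g a (fst p) (snd p) (b (fst p) (snd p)))"
      by (rule sum.cong[OF jrad_P]) (use spl[OF a] jrad_P_closed jrad_P in blast)
    also have "\<dots> = (\<Prod>p\<in>idx t n. \<Sum>b\<in>?Z (fst p) (snd p). ?g a (fst p) (snd p) b)"
      by (rule sum_box_prod) (simp add: finJ in_idx_def)
    also have "\<dots> = (\<Prod>p\<in>idx t n. if a (fst p) (snd p) \<in> lsoc (S (fst p) (snd p))
        then of_nat (card (jrad (S (fst p) (snd p)))) else 0)"
      by (intro prod.cong refl sum_chi_comp_jrad(1)[OF gen] idx_in_idx carrier_P_component[OF a])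
    also have "\<dots> = (if a \<in> lsoc P then J else 0)"
    proof (cases "a \<in> lsoc P")
      case True
      then show ?thesis unfolding mem_lsoc_P[OF a] J_def by (auto intro!: prod.cong)
    next
      case False
      then obtain p where p: "p \<in> idx t n" "a (fst p) (snd p) \<notin> lsoc (S (fst p) (snd p))"
        unfolding mem_lsoc_P[OF a] by blast
      then have "\<exists>p\<in>idx t n. (if a (fst p) (snd p) \<in> lsoc (S (fst p) (snd p))
          then of_nat (card (jrad (S (fst p) (snd p)))) else 0) = (0 :: complex)"
        by (intro bexI[OF _ p(1)]) simp
      then show ?thesis using False by (subst prod_zero) simp_all
    qed
    finally show ?thesis .
  qed
  have Qs: "(\<Sum>b\<in>Q m. \<chi> (b \<otimes>\<^bsub>P\<^esub> a)) = (if a \<in> lsoc P then J * K m a else 0)" if a: "a \<in> carrier P" for a m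
  proof -
    let ?B = "{b \<in> box t n (\<lambda>i j. ?Z i j \<union> ?N i j). \<forall>i<t. card {j. j < n i \<and> b i j \<in> ?N i j} = m i}"
    have box: "box t n (\<lambda>i j. ?Z i j \<union> ?N i j) = carrier P"
    proof -
      have "?Z i j \<union> ?N i j = carrier (S i j)" if "in_idx t n i j" for i j
        using finite_local_ring.jrad_closed[OF component_local[OF that]] by blast
      then show ?thesis unfolding carrier_P box_def by (intro Collect_cong) metis
    qed
    have "card {j. j < n i \<and> b i j \<in> ?N i j} = unit_wt b i" if "b \<in> carrier P" "i < t" for b i
    proof -
      have "{j. j < n i \<and> b i j \<in> ?N i j} = {j. j < n i \<and> b i j \<notin> jrad (S i j)}"
        using that unfolding carrier_P mem_box by blast
      then show ?thesis by (simp add: unit_wt_def)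
    qed
    then have B: "Q m = ?B" unfolding box Q_def by auto
    have "(\<Sum>b\<in>?B. \<chi> (b \<otimes>\<^bsub>P\<^esub> a)) = (\<Sum>b\<in>?B. \<Prod>p\<in>idx t n. ?g a (fst p) (snd p) (b (fst p) (snd p)))"
      by (rule sum.cong) (use spl[OF a] box in auto)
    also have "\<dots> = (\<Sum>U\<in>supports t n m. (\<Prod>p\<in>U. \<Sum>b\<in>?N (fst p) (snd p). ?g a (fst p) (snd p) b)
            * (\<Prod>p\<in>idx t n - U. \<Sum>b\<in>?Z (fst p) (snd p). ?g a (fst p) (snd p) b))"
      by (rule sum_weight_block[of t n ?Z ?N "?g a"]) (auto simp: finJ finite_component in_idx_def)
    also have "\<dots> = (\<Sum>U\<in>supports t n m. if a \<in> lsoc P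
        then J * (\<Prod>p\<in>U. if a (fst p) (snd p) \<noteq> \<zero>\<^bsub>S (fst p) (snd p)\<^esub> then - 1 else of_nat (q (fst p)) - 1) else 0)"
    proof (rule sum.cong[OF refl])
      fix U assume "U \<in> supports t n m"
      then have U: "U \<subseteq> idx t n" by (simp add: supports_def)
      then have finU: "finite U" by (rule finite_subset) simp
      let ?l = "(\<Prod>p\<in>U. \<Sum>b\<in>?N (fst p) (snd p). ?g a (fst p) (snd p) b)"
      let ?r = "(\<Prod>p\<in>idx t n - U. \<Sum>b\<in>?Z (fst p) (snd p). ?g a (fst p) (snd p) b)"
      let ?k = "\<lambda>p. if a (fst p) (snd p) \<noteq> \<zero>\<^bsub>S (fst p) (snd p)\<^esub> then - 1 else of_nat (q (fst p)) - 1 :: complex"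
      let ?j = "\<lambda>p. of_nat (card (jrad (S (fst p) (snd p)))) :: complex"
      have ac: "a (fst p) (snd p) \<in> carrier (S (fst p) (snd p))" if "p \<in> idx t n" for p
        by (rule carrier_P_component[OF a idx_in_idx[OF that]])
      show "?l * ?r = (if a \<in> lsoc P then J * (\<Prod>p\<in>U. ?k p) else 0)"
      proof (cases "a \<in> lsoc P")
        case True
        then have soc: "a (fst p) (snd p) \<in> lsoc (S (fst p) (snd p))" if "p \<in> idx t n" for p
          using that unfolding mem_lsoc_P[OF a] by blast
        have "?l = (\<Prod>p\<in>U. ?j p * ?k p)"
        proof (rule prod.cong[OF refl])
          fix p assume "p \<in> U"
          then have p: "p \<in> idx t n" using U by blast
          show "(\<Sum>b\<in>?N (fst p) (snd p). ?g a (fst p) (snd p) b) = ?j p * ?k p"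
            by (rule sum_chi_comp_jrad(2)[OF gen idx_in_idx[OF p] ac[OF p] soc[OF p]])
        qed
        moreover have "?r = (\<Prod>p\<in>idx t n - U. ?j p)"
        proof (rule prod.cong[OF refl])
          fix p assume "p \<in> idx t n - U"
          then have p: "p \<in> idx t n" by blast
          show "(\<Sum>b\<in>?Z (fst p) (snd p). ?g a (fst p) (snd p) b) = ?j p"
            using sum_chi_comp_jrad(1)[OF gen idx_in_idx[OF p] ac[OF p]] soc[OF p] by simp
        qed
        \<comment> \<open>Positions in \<open>U\<close> and outside \<open>U\<close> each contribute
          the size of their radical, so every support carries the same factor
          \<open>J\<close>.\<close>
        moreover have "J = (\<Prod>p\<in>idx t n - U. ?j p) * (\<Prod>p\<in>U. ?j p)"
          unfolding J_def by (rule prod.subset_diff[OF U]) simp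
        ultimately show ?thesis using True by (simp add: prod.distrib)
      next
        case False
        then obtain p where p: "p \<in> idx t n" "a (fst p) (snd p) \<notin> lsoc (S (fst p) (snd p))"
          unfolding mem_lsoc_P[OF a] by blast
        \<comment> \<open>At a position outside the socle both the radical sum and the complementary
          sum vanish, so the term is 0 whether or not \<open>p\<close> belongs to
          \<open>U\<close>.\<close>
        have "?l * ?r = 0"
        proof (cases "p \<in> U")
          case True
          have "(\<Sum>b\<in>?N (fst p) (snd p). ?g a (fst p) (snd p) b) = 0"
            by (rule sum_chi_comp_jrad(3)[OF gen idx_in_idx[OF p(1)] ac[OF p(1)] p(2)])
          then have "?l = 0" using True finU by (intro prod_zero) auto
          then show ?thesis by simp
        next
          case notU: False
          have "(\<Sum>b\<in>?Z (fst p) (snd p). ?g a (fst p) (snd p) b) = 0"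
            using sum_chi_comp_jrad(1)[OF gen idx_in_idx[OF p(1)] ac[OF p(1)]] p(2) by simp
          moreover have "p \<in> idx t n - U" using p(1) notU by blast
          ultimately have "?r = 0" by (intro prod_zero) (simp, blast)
          then show ?thesis by simp
        qed
        then show ?thesis using False by simp
      qed
    qed
    also have "\<dots> = (if a \<in> lsoc P then J * K m a else 0)"
      by (simp add: K_def krawtchouk_def sum_distrib_left)
    finally show ?thesis unfolding B .
  qed
  have Qblock: "{b \<in> carrier P - jrad P. \<forall>i<t. unit_wt b i = m i} = Q m" if "\<exists>i<t. m i \<noteq> 0" for m
    unfolding Q_def using that jrad_iff_unit_wt by auto
  have H: "B \<in> H'_dual t n S \<longleftrightarrow> B \<noteq> {} \<and> (B = jrad P - {\<zero>\<^bsub>P\<^esub>} \<or> B = {\<zero>\<^bsub>P\<^esub>} \<or>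
      (\<exists>m. in_M t n m \<and> (\<exists>i<t. m i \<noteq> 0) \<and> B = Q m))" for B
  proof -
    have "(in_M t n m \<and> (\<exists>i<t. m i \<noteq> 0) \<and> B = {b \<in> carrier P - jrad P. \<forall>i<t. unit_wt b i = m i})
        = (in_M t n m \<and> (\<exists>i<t. m i \<noteq> 0) \<and> B = Q m)" for m
      by (intro conj_cong refl) (simp only: Qblock)
    then show ?thesis unfolding H'_dual_def unit_wt_def[symmetric] by (simp only: mem_Collect_eq)
  qed
  have finjr: "finite (jrad P)" by (rule finite_subset[OF _ finite_P]) (use jrad_P_closed in blast)
  have jr0: "(\<Sum>b\<in>jrad P - {\<zero>\<^bsub>P\<^esub>}. \<chi> (b \<otimes>\<^bsub>P\<^esub> a)) = (if a \<in> lsoc P then J else 0) - 1" if "a \<in> carrier P" for a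
    using sum.remove[OF finjr zero_in_jrad_P, of "\<lambda>b. \<chi> (b \<otimes>\<^bsub>P\<^esub> a)"] jr[OF that] that
    by (simp add: chi_zero[OF gen])
  show ?thesis
  proof
    assume same: "same_weight a a'"
    have Keq: "K m a = K m a'" if "a \<in> lsoc P" for m
      unfolding K_def by (rule krawtchouk_cong) (use same that in \<open>simp add: same_weight_def wt_def\<close>)
    have soc: "a \<in> lsoc P \<longleftrightarrow> a' \<in> lsoc P" using same by (simp add: same_weight_def)
    show "\<forall>B\<in>H'_dual t n S. (\<Sum>b\<in>B. \<chi> (b \<otimes>\<^bsub>P\<^esub> a)) = (\<Sum>b\<in>B. \<chi> (b \<otimes>\<^bsub>P\<^esub> a'))"
    proof
      fix B assume "B \<in> H'_dual t n S"
      then consider "B = jrad P - {\<zero>\<^bsub>P\<^esub>}" | "B = {\<zero>\<^bsub>P\<^esub>}" | m where "B = Q m" unfolding H by blast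
      then show "(\<Sum>b\<in>B. \<chi> (b \<otimes>\<^bsub>P\<^esub> a)) = (\<Sum>b\<in>B. \<chi> (b \<otimes>\<^bsub>P\<^esub> a'))"
      proof cases
        case 1
        show ?thesis unfolding 1 jr0[OF aa'(1)] jr0[OF aa'(2)] using soc by simp
      next
        case 2
        show ?thesis unfolding 2 using aa' by simp
      next
        case 3
        show ?thesis unfolding 3 Qs[OF aa'(1)] Qs[OF aa'(2)] using soc Keq by simp
      qed
    qed
  next
    assume eq: "\<forall>B\<in>H'_dual t n S. (\<Sum>b\<in>B. \<chi> (b \<otimes>\<^bsub>P\<^esub> a)) = (\<Sum>b\<in>B. \<chi> (b \<otimes>\<^bsub>P\<^esub> a'))"
    have "(\<Sum>b\<in>jrad P - {\<zero>\<^bsub>P\<^esub>}. \<chi> (b \<otimes>\<^bsub>P\<^esub> a)) = (\<Sum>b\<in>jrad P - {\<zero>\<^bsub>P\<^esub>}. \<chi> (b \<otimes>\<^bsub>P\<^esub> a'))"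
    proof (cases "jrad P - {\<zero>\<^bsub>P\<^esub>} = {}")
      case False
      then have "jrad P - {\<zero>\<^bsub>P\<^esub>} \<in> H'_dual t n S" unfolding H by blast
      then show ?thesis using eq by blast
    qed (simp only: sum.empty)
    \<comment> \<open>The compared values are \<open>J - 1\<close> on the socle and -1 off it,
      distinct because \<open>J\<close> is nonzero.\<close>
    then have soc: "a \<in> lsoc P \<longleftrightarrow> a' \<in> lsoc P"
      unfolding jr0[OF aa'(1)] jr0[OF aa'(2)] using J by (auto split: if_splits)
    moreover have "wt n S a k = wt n S a' k" if a: "a \<in> lsoc P" and k: "k < t" for k
    proof (cases "n k = 0")
      case False
      let ?m = "\<lambda>i. if i = k then 1 else 0 :: nat"
      have "(\<Sum>b\<in>Q ?m. \<chi> (b \<otimes>\<^bsub>P\<^esub> a)) = (\<Sum>b\<in>Q ?m. \<chi> (b \<otimes>\<^bsub>P\<^esub> a'))"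
      proof (cases "Q ?m = {}")
        case nonempty: False
        have "in_M t n ?m" using False by (auto simp: in_M_def)
        moreover have "\<exists>i<t. ?m i \<noteq> 0" using k by auto
        ultimately have "Q ?m \<in> H'_dual t n S" using nonempty unfolding H by blast
        then show ?thesis using eq by blast
      qed (simp only: sum.empty)
      then have "K ?m a = K ?m a'" unfolding Qs[OF aa'(1)] Qs[OF aa'(2)] using soc a J by simp
      then show ?thesis unfolding K_def wt_def by (rule krawtchouk_unit_inj[OF k])
    qed (simp add: wt_def)
    ultimately show "same_weight a a'" by (simp add: same_weight_def)
  qed
qed

section \<open>Reflexivity, the homogeneous partition and the semisimple case\<close>

lemma left_dual_H'_dual:
  assumes gen: "generating_char P \<chi>"
  shows "left_dual P \<chi> (H'_dual t n S) = H' t n S"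
  unfolding left_dual_def H'_eq_classes
  by (intro image_cong refl) (use dual_unit_wt_classes_iff[OF gen] in blast)

lemma P_hom_eq_H':
  assumes "separating t n q"
  shows "P_hom P = H' t n S"
  unfolding P_hom_def H'_eq_classes
proof (rule image_cong[OF refl])
  fix x assume x: "x \<in> carrier P"
  show "{y \<in> carrier P. hom_weight P y = hom_weight P x} = {b \<in> carrier P. same_weight x b}"
    using hom_weight_eq_iff[OF assms x] by (auto simp: eq_commute)
qed

text \<open>Here 1 lies in the socle and is therefore killed by every radical element.\<close>

lemma semisimple_jrad:
  assumes ss: "carrier P = lsoc P" and ij: "in_idx t n i j"
  shows "jrad (S i j) = {\<zero>\<^bsub>S i j\<^esub>}"
proof -
  interpret C: simple_socle_ring "S i j" by (rule component[OF ij])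
  have "\<one>\<^bsub>P\<^esub> \<in> lsoc P" using ss P.one_closed by simp
  then have "\<one>\<^bsub>S i j\<^esub> \<in> lsoc (S i j)" using ij unfolding lsoc_P box_def by (auto simp: P_simps)
  then have ann: "r \<otimes>\<^bsub>S i j\<^esub> \<one>\<^bsub>S i j\<^esub> = \<zero>\<^bsub>S i j\<^esub>" if "r \<in> jrad (S i j)" for r
    using that unfolding C.lsoc_eq by blast
  have "r = \<zero>\<^bsub>S i j\<^esub>" if "r \<in> jrad (S i j)" for r
    using ann[OF that] C.jrad_closed[OF that] by simp
  then show ?thesis using left_ideal_closed(2)[OF C.jrad_left_ideal] by blast
qed

text \<open>With zero radical, nonradical means nonzero, so unit weights are weights. An element is
  0 exactly when all of them vanish, so both relations compare the same data.\<close>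

lemma semisimple_self_dual:
  assumes ss: "carrier P = lsoc P"
  shows "H'_dual t n S = H' t n S"
proof -
  have uw: "unit_wt a i = wt n S a i" if "i < t" for a i
  proof -
    have "{j. j < n i \<and> a i j \<notin> jrad (S i j)} = {j. j < n i \<and> a i j \<noteq> \<zero>\<^bsub>S i j\<^esub>}"
      using semisimple_jrad[OF ss, of i] that by (auto simp: in_idx_def)
    then show ?thesis by (simp add: unit_wt_def wt_def)
  qed
  have "jrad P = {\<zero>\<^bsub>P\<^esub>}"
  proof (intro equalityI subsetI)
    fix a assume a: "a \<in> jrad P"
    have "a = \<zero>\<^bsub>P\<^esub>"
    proof (rule P_eqI[OF jrad_P_closed[OF a] P.zero_closed])
      fix i j assume ij: "in_idx t n i j"
      have "a i j \<in> jrad (S i j)" using a ij unfolding jrad_P box_def by blast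
      then show "a i j = \<zero>\<^bsub>P\<^esub> i j" using semisimple_jrad[OF ss ij] ij by (simp add: P_simps)
    qed
    then show "a \<in> {\<zero>\<^bsub>P\<^esub>}" by simp
  qed (use zero_in_jrad_P in simp)
  then have zero: "a = \<zero>\<^bsub>P\<^esub> \<longleftrightarrow> (\<forall>i<t. unit_wt a i = 0)" if "a \<in> carrier P" for a
    using jrad_iff_unit_wt[OF that] by simp
  have "same_unit_wt a b \<longleftrightarrow> same_weight a b" if "a \<in> carrier P" "b \<in> carrier P" for a b
    using zero[OF that(1)] zero[OF that(2)] that ss uw by (auto simp: same_unit_wt_def same_weight_def)
  then show ?thesis unfolding H'_eq_classes H'_dual_eq_classes by (intro image_cong refl) blast
qed

end

theorem theorem4p4:
  fixes t :: nat and n q :: "nat \<Rightarrow> nat"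
    and S :: "nat \<Rightarrow> nat \<Rightarrow> ('c, 'm) ring_scheme"
  assumes comps: "\<And>i j. i < t \<Longrightarrow> j < n i \<Longrightarrow>
        ring (S i j) \<and> finite (carrier (S i j)) \<and> local_ring (S i j) \<and> frobenius (S i j)
        \<and> card (a_rcosets\<^bsub>S i j\<^esub> (jrad (S i j))) = q i \<and> card (lsoc (S i j)) = q i"
    and n_pos: "\<And>i. i < t \<Longrightarrow> 1 \<le> n i"
    and q_distinct: "inj_on q {..<t}"
    and sep: "separating t n q"
  shows "P_hom (prod_ring t n S) = H' t n S
     \<and> (\<forall>\<chi>. generating_char (prod_ring t n S) \<chi> \<longrightarrow>
           reflexive_partition (prod_ring t n S) \<chi> (P_hom (prod_ring t n S))
         \<and> left_dual (prod_ring t n S) \<chi> (P_hom (prod_ring t n S)) = H'_dual t n S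
         \<and> right_dual (prod_ring t n S) \<chi> (P_hom (prod_ring t n S)) = H'_dual t n S)
     \<and> (carrier (prod_ring t n S) = lsoc (prod_ring t n S) \<longrightarrow>
           P_hom (prod_ring t n S) = hamming_prod t n S
         \<and> (\<forall>\<chi>. generating_char (prod_ring t n S) \<chi> \<longrightarrow>
               self_dual_partition (prod_ring t n S) \<chi> (P_hom (prod_ring t n S))))"
proof -
  interpret socle_product t n q S
  proof (rule socle_product.intro)
    fix i j assume "in_idx t n i j"
    then have ij: "i < t" "j < n i" by (simp_all add: in_idx_def)
    show "simple_socle_ring (S i j)"
      using comps[OF ij] by (simp add: simple_socle_ring_def simple_socle_ring_axioms_def
          finite_local_ring_def finite_local_ring_axioms_def)
    show "card (lsoc (S i j)) = q i" using comps[OF ij] by simp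
  qed
  have hom: "P_hom P = H' t n S" by (rule P_hom_eq_H'[OF sep])
  \<comment> \<open>The complement of the socle is empty and so gives no block.\<close>
  have ham: "H' t n S = hamming_prod t n S" if "carrier P = lsoc P"
    using that unfolding H'_def hamming_prod_def by auto
  have self: "right_dual P \<chi> (H' t n S) = H' t n S" if "generating_char P \<chi>" "carrier P = lsoc P" for \<chi>
    using dual_H'(1)[OF that(1)] semisimple_self_dual[OF that(2)] by simp
  show ?thesis
    unfolding hom reflexive_partition_def self_dual_partition_def
    using ham self by (auto simp only: dual_H' left_dual_H'_dual)
qed

end
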